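(* For every integer $k\ge 1$, $$\zeta(4k+1)=\frac{(2\pi)^{4k+1}}{2b_k}\sum_{j=0}^k \frac{(-1)^{j+1}\, c_{jk}\, B_{2j}\, B_{4k+2-2j}}{(2j)!\,(4k+2-2j)!}+\frac{(-1)^k2^{2k+1}}{b_k}\,\mathcal{L}_{-e^{-3\pi}}(-4k-1)-\frac{a_k}{2^{4k-1}b_k}\,\mathcal{L}_{e^{-4\pi}}(-4k-1)+\frac{2^{2k}}{2^{2k-1}b_k}\,\mathcal{L}_{e^{-6\pi}}(-4k-1),$$ where $$a_k=\frac{2^{4k}\left(3^{4k+1}+1\right)}{2^{4k+1}-(-1)^k2^{2k}+1},$$ $$b_k=\frac{3^{4k+1}-1}{2}-(-1)^k\,2^{2k}-a_k\left[\frac{2^{4k+1}-(-1)^k2^{2k}-1}{2^{4k+1}}\right],$$ $$c_{jk}=3^{2j-1}\sum_{n=-1}^{1}(1+in)^{4k+1-2j}-3^{4k+1-2j}\sum_{n=-1}^{1}(1+in)^{2j-1}-a_k\left[\frac{1+(1+i)^{4k+1-2j}}{2^{4k+1-2j}}-\frac{1+(1+i)^{2j-1}}{2^{2j-1}}\right].$$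
   Context: For complex $q$ with $|q|<1$ and $s\in\mathbb{C}$, the Lambert series is $\mathcal{L}_q(s)=\sum_{n=1}^\infty \frac{n^s q^n}{1-q^n}$. $\zeta$ is the Riemann zeta function, $B_m$ is the $m$th Bernoulli number, and $i=\sqrt{-1}$ (the coefficients $c_{jk}$ are in general complex numbers). *)

theory Defs
  imports "HOL-Analysis.Analysis" "HOL-Computational_Algebra.Formal_Power_Series"
begin

text \<open>
  The Riemann zeta function: the Dirichlet series on the half plane \<open>Re s > 1\<close>, and elsewhere
  (away from the pole \<open>s = 1\<close>) the value of the analytic continuation, which is
  unique by the identity theorem.  The value at \<open>s = 1\<close> is meaningless.
\<close>

definition zeta_series :: "complex \<Rightarrow> complex" where
  "zeta_series s = (\<Sum>n. 1 / of_nat (Suc n) powr s)"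

definition zeta :: "complex \<Rightarrow> complex" where
  "zeta s =
     (if Re s > 1 then zeta_series s
      else (THE w. \<exists>f. f holomorphic_on (- {1}) \<and>
                       (\<forall>z. Re z > 1 \<longrightarrow> f z = zeta_series z) \<and> w = f s))"

text \<open>
  Generating function \<open>x / (e\<^sup>x - 1) = (\<Sum>m. B\<^sub>m x\<^sup>m / m!)\<close>, so \<open>B\<^sub>1 = - 1 / 2\<close>.
  Formal power series division cancels the common factor \<open>x\<close>.
\<close>

definition bernoulli :: "nat \<Rightarrow> real" where
  "bernoulli m = fact m * fps_nth (fps_X / (fps_exp 1 - 1)) m"

lemma bernoulli_fps:
  "Abs_fps (\<lambda>m. bernoulli m / fact m) * (fps_exp 1 - 1) = fps_X"
proof -
  have nz: "fps_nth (fps_exp (1::real) - 1) 1 \<noteq> 0"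
    by simp
  then have "fps_exp (1::real) - 1 \<noteq> 0"
    by (metis fps_zero_nth)
  moreover have "subdegree (fps_exp (1::real) - 1) \<le> subdegree (fps_X :: real fps)"
    using nz by (simp add: subdegree_leI)
  ultimately have "fps_exp (1::real) - 1 dvd fps_X"
    by (simp add: fps_dvd_iff)
  moreover have "Abs_fps (\<lambda>m. bernoulli m / fact m) = fps_X / (fps_exp 1 - 1)"
    by (simp add: bernoulli_def fps_eq_iff)
  ultimately show ?thesis
    by simp
qed

text \<open>Only meaningful for \<open>norm q < 1\<close>; the power \<open>n\<^sup>s\<close> is the principal one, as \<open>n > 0\<close>.\<close>

definition lambert :: "complex \<Rightarrow> complex \<Rightarrow> complex" where
  "lambert q s = (\<Sum>n. of_nat (Suc n) powr s * q ^ Suc n / (1 - q ^ Suc n))"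

definition a_coeff :: "nat \<Rightarrow> real" where
  "a_coeff k = 2 ^ (4*k) * (3 ^ (4*k+1) + 1) / (2 ^ (4*k+1) - (-1) ^ k * 2 ^ (2*k) + 1)"

definition b_coeff :: "nat \<Rightarrow> real" where
  "b_coeff k = (3 ^ (4*k+1) - 1) / 2 - (-1) ^ k * 2 ^ (2*k)
     - a_coeff k * ((2 ^ (4*k+1) - (-1) ^ k * 2 ^ (2*k) - 1) / 2 ^ (4*k+1))"

text \<open>Integer exponents, since \<open>2 j - 1 = - 1\<close> for \<open>j = 0\<close>.\<close>

definition c_coeff :: "nat \<Rightarrow> nat \<Rightarrow> complex" where
  "c_coeff j k =
     (let r = 4 * int k + 1 - 2 * int j; t = 2 * int j - 1
      in 3 powi t * (\<Sum>n\<in>{-1..1::int}. (1 + \<i> * of_int n) powi r)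
         - 3 powi r * (\<Sum>n\<in>{-1..1::int}. (1 + \<i> * of_int n) powi t)
         - of_real (a_coeff k) *
             ((1 + (1 + \<i>) powi r) / 2 powi r - (1 + (1 + \<i>) powi t) / 2 powi t))"

end

theory Submission
  imports Defs "HOL-Number_Theory.Cong"
begin

text \<open>
  For \<open>s = 4 k + 1\<close> and \<open>q = exp (2 \<pi> \<i> \<tau>)\<close> with \<open>Im \<tau> > 0\<close>, the cotangent sum
  \<open>C(\<tau>) = (\<Sum>n. cot (\<pi> n \<tau>) / n\<^sup>s)\<close> equals \<open>- \<i> (\<zeta>(s) + 2 L\<^sub>q(- s))\<close>.  It is odd, has period \<open>1\<close>,
  and satisfies Ramanujan's formula, which expresses \<open>C(\<tau>) + \<tau>\<^bsup>s-1\<^esup> C(1 / \<tau>)\<close> by Bernoulli numbers.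
  As \<open>C\<close> is moreover an eigenfunction of the Hecke operators, the sum of \<open>C((\<tau> + j) / p)\<close> over
  \<open>j < p\<close> is a combination of \<open>C(\<tau>)\<close> and \<open>C(p \<tau>)\<close>.  Take \<open>\<tau> = \<i>\<close>.  For \<open>p = 3\<close>, inversion
  moves the points \<open>\<i> / 3\<close> and \<open>(\<i> \<plusminus> 1) / 3\<close> to \<open>3 \<i>\<close> and (up to integer translation)
  \<open>3 (\<i> - 1) / 2\<close>, where \<open>q\<close> is \<open>exp (- 6 \<pi>)\<close> and \<open>- exp (- 3 \<pi>)\<close>.  For \<open>p = 2\<close>, it moves
  \<open>\<i> / 2\<close> and \<open>(\<i> - 1) / 2\<close> to \<open>2 \<i>\<close>, where \<open>q = exp (- 4 \<pi>)\<close>, and to \<open>\<i>\<close>.  Eliminating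
  \<open>C(\<i>)\<close> between the two relations leaves a linear equation for \<open>\<zeta>(s)\<close>.
\<close>

section \<open>The partial fraction expansion of the cotangent\<close>

text \<open>The logarithmic derivative of Euler's reflection formula: both sides of Gamma(z) Gamma(1
  - z) = pi / sin(pi z) are differentiated and the common nonzero factor is cancelled.\<close>

lemma Digamma_reflection:
  assumes "z \<notin> \<int>"
  shows "Digamma (1 - z) - Digamma z = of_real pi * cot (of_real pi * z :: complex)"
proof -
  have z: "z \<notin> \<int>\<^sub>\<le>\<^sub>0" "1 - z \<notin> \<int>\<^sub>\<le>\<^sub>0"
    using assms nonpos_Ints_subset_Ints Ints_diff[OF Ints_1, of "1 - z"] by auto
  have s: "sin (of_real pi * z) \<noteq> 0"
    using assms by (auto simp: sin_eq_0 field_simps)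
  have "((\<lambda>z. Gamma z * Gamma (1 - z)) has_field_derivative
          Gamma z * Gamma (1 - z) * (Digamma z - Digamma (1 - z))) (at z)"
    using z by (auto intro!: derivative_eq_intros simp: algebra_simps)
  moreover have "((\<lambda>z. of_real pi / sin (of_real pi * z)) has_field_derivative
          - (of_real pi / sin (of_real pi * z) * (of_real pi * cot (of_real pi * z)))) (at z)"
    using s by (auto intro!: derivative_eq_intros simp: cot_def power2_eq_square field_simps)
  ultimately have "Gamma z * Gamma (1 - z) * (Digamma z - Digamma (1 - z)) =
      - (of_real pi / sin (of_real pi * z) * (of_real pi * cot (of_real pi * z)))"
    unfolding Gamma_reflection_complex by (rule DERIV_unique)
  hence "of_real pi / sin (of_real pi * z) * (Digamma (1 - z) - Digamma z) =
      of_real pi / sin (of_real pi * z) * (of_real pi * cot (of_real pi * z))"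
    unfolding Gamma_reflection_complex
    by (metis minus_diff_eq minus_equation_iff mult_minus_right)
  thus ?thesis
    using s by simp
qed

text \<open>Each term splits into two simple fractions, so a partial sum is a difference of two
  shifted harmonic sums. Subtracted from \<open>ln m\<close> these tend to \<open>Digamma z\<close>
  and \<open>Digamma (1 - z)\<close>; the logarithms cancel and reflection gives the
  cotangent.\<close>

lemma cot_partial_fractions:
  assumes "z \<notin> \<int>"
  shows "(\<lambda>n. 2 * z / (z\<^sup>2 - of_nat (Suc n) ^ 2)) sums
           (of_real pi * cot (of_real pi * z) - 1 / z :: complex)"
proof -
  have ne: "z + of_nat n \<noteq> 0" "1 - z + of_nat n \<noteq> 0" for n
    using assms Ints_diff[OF Ints_0 Ints_of_nat[of n]] Ints_add[OF Ints_1 Ints_of_nat[of n]]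
    by (auto simp: algebra_simps eq_neg_iff_add_eq_0 dest!: eq_neg_iff_add_eq_0[THEN iffD2])
  \<comment> \<open>The split produces \<open>inverse (z + of_nat (Suc n))\<close>, whereas the
    Digamma limit starts at \<open>inverse z\<close>; the last two summands correct this
    shift.\<close>
  have partial: "(\<Sum>n<m. 2 * z / (z\<^sup>2 - of_nat (Suc n) ^ 2)) =
      (\<Sum>n<m. inverse (z + of_nat n)) - (\<Sum>n<m. inverse (1 - z + of_nat n))
        - 1 / z + inverse (z + of_nat m)" for m
  proof (induction m)
    case 0
    thus ?case by (simp add: divide_inverse)
  next
    case (Suc m)
    have f: "z\<^sup>2 - of_nat (Suc m) ^ 2 = - ((z + of_nat (Suc m)) * (1 - z + of_nat m))"
      by (simp add: power2_eq_square algebra_simps)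
    have "2 * z / (z\<^sup>2 - of_nat (Suc m) ^ 2) =
            inverse (z + of_nat (Suc m)) - inverse (1 - z + of_nat m)"
      unfolding f using ne(1)[of "Suc m"] ne(2)[of m] by (simp add: divide_simps)
    thus ?case using Suc.IH by simp
  qed
  have "(\<lambda>m. inverse (z + of_nat m)) \<longlonglongrightarrow> 0"
    by (intro tendsto_inverse_0[THEN filterlim_compose] tendsto_of_nat
          tendsto_add_filterlim_at_infinity[OF tendsto_const])
  note lim0 = this
  have "(\<lambda>m. (of_real (ln (real m)) - (\<Sum>n<m. inverse (1 - z + of_nat n))) -
      (of_real (ln (real m)) - (\<Sum>n<m. inverse (z + of_nat n)))) \<longlonglongrightarrow> Digamma (1 - z) - Digamma z"
    using ne(1)[of 0] ne(2)[of 0] by (intro tendsto_diff Digamma_LIMSEQ) auto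
  note lim1 = this
  have "(\<lambda>m. (of_real (ln (real m)) - (\<Sum>n<m. inverse (1 - z + of_nat n))) -
      (of_real (ln (real m)) - (\<Sum>n<m. inverse (z + of_nat n))) - 1 / z + inverse (z + of_nat m))
      \<longlonglongrightarrow> Digamma (1 - z) - Digamma z - 1 / z + 0"
    by (rule tendsto_add[OF tendsto_diff[OF lim1 tendsto_const] lim0])
  thus ?thesis
    unfolding sums_def partial Digamma_reflection[OF assms] by (simp add: algebra_simps)
qed

text \<open>Translates between unordered sums over the positive integers, which allow Fubini and
  reindexing, and series indexed from \<open>0\<close>.\<close>

lemma has_sum_pos_nat_iff:
  fixes f :: "nat \<Rightarrow> 'a :: {comm_monoid_add, topological_space}"
  shows "(f has_sum S) {0<..} \<longleftrightarrow> ((\<lambda>n. f (Suc n)) has_sum S) UNIV"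
  using has_sum_reindex[of Suc UNIV f S] unfolding greaterThan_0 o_def by simp

lemma inverse_power_norm_summable:
  assumes "p \<ge> 2"
  shows "(\<lambda>n. norm (1 / of_nat n ^ p :: complex)) summable_on {0<..}"
proof -
  have "summable (\<lambda>n. 1 / real (Suc n) ^ p)"
    using inverse_power_summable[OF assms, where ?'a = real, THEN summable_Suc_iff[THEN iffD2]]
    by (simp add: divide_inverse)
  hence "(\<lambda>n. 1 / real (Suc n) ^ p) summable_on UNIV"
    by (intro norm_summable_imp_summable_on) simp
  thus ?thesis
    unfolding summable_on_def has_sum_pos_nat_iff by (simp add: norm_divide norm_power del: of_nat_Suc)
qed

lemma cot_partial_fractions_has_sum:
  assumes "z \<notin> \<int>"
  shows "((\<lambda>n. 2 * z / (z\<^sup>2 - of_nat n ^ 2)) has_sum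
           (of_real pi * cot (of_real pi * z) - 1 / z :: complex)) {0<..}"
  unfolding has_sum_pos_nat_iff
proof (rule norm_summable_imp_has_sum[OF _ cot_partial_fractions[OF assms]])
  have "summable (\<lambda>n. 1 / real (Suc n) ^ 2)"
    using inverse_power_summable[of 2, where ?'a = real, THEN summable_Suc_iff[THEN iffD2]]
    by (simp add: divide_inverse)
  hence "summable (\<lambda>n. 4 * norm z * (1 / real (Suc n) ^ 2))"
    by (rule summable_mult)
  moreover have "eventually (\<lambda>n. norm (norm (2 * z / (z\<^sup>2 - of_nat (Suc n) ^ 2))) \<le>
                     4 * norm z * (1 / real (Suc n) ^ 2)) sequentially"
    \<comment> \<open>From \<open>2 * norm z \<le> real (Suc n)\<close> on, the square of
      \<open>z\<close> is at most half of the square of \<open>Suc n\<close>, so the denominator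
      stays above the other half. This is the source of the factor \<open>4\<close>.\<close>
    using eventually_ge_at_top[of "nat \<lceil>2 * norm z\<rceil>"]
  proof eventually_elim
    case (elim n)
    hence "2 * norm z \<le> real (Suc n)" by linarith
    hence "norm z ^ 2 \<le> (real (Suc n) / 2) ^ 2" by (intro power_mono) auto
    also have "\<dots> \<le> real (Suc n) ^ 2 / 2" by (simp add: power_divide)
    finally have "norm (z ^ 2) \<le> real (Suc n) ^ 2 / 2" by (simp add: norm_power)
    hence "real (Suc n) ^ 2 / 2 \<le> norm (of_nat (Suc n) ^ 2 :: complex) - norm (z\<^sup>2)"
      by (simp add: norm_power del: of_nat_Suc)
    also have "\<dots> \<le> norm (z\<^sup>2 - of_nat (Suc n) ^ 2)"
      by (metis norm_minus_commute norm_triangle_ineq2)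
    finally have *: "real (Suc n) ^ 2 / 2 \<le> norm (z\<^sup>2 - of_nat (Suc n) ^ 2)" .
    have "norm (2 * z / (z\<^sup>2 - of_nat (Suc n) ^ 2)) \<le> 2 * norm z / (real (Suc n) ^ 2 / 2)"
      unfolding norm_divide using * by (intro frac_le) (auto simp: norm_mult)
    thus ?case by simp
  qed
  ultimately show "summable (\<lambda>n. norm (2 * z / (z\<^sup>2 - of_nat (Suc n) ^ 2)))"
    by (rule summable_comparison_test_ev[rotated])
qed

section \<open>Even zeta values\<close>

lemma norm_summable_on_Times_product:
  fixes f :: "'a \<Rightarrow> 'c :: real_normed_field" and g :: "'b \<Rightarrow> 'c"
  assumes "(\<lambda>x. norm (f x)) summable_on A" "(\<lambda>y. norm (g y)) summable_on B"
  shows "(\<lambda>(x, y). norm (f x * g y)) summable_on A \<times> B"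
proof (rule summable_on_SigmaI[where g = "\<lambda>x. norm (f x) * (\<Sum>\<^sub>\<infinity>y\<in>B. norm (g y))"])
  show "((\<lambda>y. case (x, y) of (x, y) \<Rightarrow> norm (f x * g y)) has_sum
           norm (f x) * (\<Sum>\<^sub>\<infinity>y\<in>B. norm (g y))) B" for x
    using assms(2) by (simp add: norm_mult has_sum_cmult_right has_sum_infsum)
  show "(\<lambda>x. norm (f x) * (\<Sum>\<^sub>\<infinity>y\<in>B. norm (g y))) summable_on A"
    by (intro summable_on_cmult_left assms)
qed auto

lemma has_sum_Times_product:
  fixes f :: "'a \<Rightarrow> 'c :: {real_normed_field, banach}" and g :: "'b \<Rightarrow> 'c"
  assumes "(\<lambda>x. norm (f x)) summable_on A" "(\<lambda>y. norm (g y)) summable_on B"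
  shows "((\<lambda>(x, y). f x * g y) has_sum infsum f A * infsum g B) (A \<times> B)"
proof -
  have "(\<lambda>(x, y). f x * g y) summable_on A \<times> B"
    using norm_summable_on_Times_product[OF assms]
    by - (rule abs_summable_summable, simp add: case_prod_unfold)
  moreover have "infsum (\<lambda>(x, y). f x * g y) (A \<times> B) = infsum f A * infsum g B"
    by (subst infsum_Sigma'_banach [symmetric], fact calculation)
       (simp add: infsum_cmult_left' infsum_cmult_right')
  ultimately show ?thesis by (simp add: has_sum_iff)
qed

text \<open>With the value \<open>\<zeta>(0) = - 1 / 2\<close>, the boundary terms of the inversion formula
  and of the Bernoulli evaluation need no special treatment.\<close>
definition zeta_even :: "nat \<Rightarrow> complex" where
  "zeta_even j = (if j = 0 then - 1 / 2 else \<Sum>\<^sub>\<infinity>n\<in>{0<..}. 1 / of_nat n ^ (2 * j))"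

text \<open>Every partial fraction of the cotangent is expanded as a geometric series in
  \<open>(z / n)\<^sup>2\<close>, and the two summations are interchanged.\<close>

lemma zeta_even_cot:
  assumes "norm z < 1" "z \<noteq> 0"
  shows "(\<lambda>j. zeta_even j * z ^ (2 * j)) sums (- (of_real pi * z * cot (of_real pi * z)) / 2)"
proof -
  define f :: "nat \<Rightarrow> nat \<Rightarrow> complex" where "f = (\<lambda>n j. (z / of_nat n) ^ (2 * j))"
  have "z \<notin> \<int>"
  proof
    assume "z \<in> \<int>"
    then obtain a :: int where "z = of_int a" by (auto elim: Ints_cases)
    thus False using assms by simp
  qed
  have geo: "(f n has_sum - (z / 2 * (2 * z / (z\<^sup>2 - of_nat n ^ 2)))) {0<..}" if "n > 0" for n
  proof -
    define w where "w = (z / of_nat n) ^ 2"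
    have "norm z * 1 < 1 * real n"
      using assms that by (intro mult_less_le_imp_less) auto
    hence w: "norm w < 1"
      using assms that by (simp add: w_def norm_power norm_divide power_less_one_iff abs_less_iff)
    hence "w \<noteq> 1" by auto
    have "((\<lambda>j. w * w ^ j) has_sum w * (1 / (1 - w))) UNIV"
      using w by (intro has_sum_cmult_right norm_summable_imp_has_sum geometric_sums)
                 (auto simp: norm_power intro!: summable_geometric)
    moreover have "z\<^sup>2 - of_nat n ^ 2 \<noteq> 0"
      using \<open>w \<noteq> 1\<close> that by (auto simp: w_def power_divide)
    hence "w * (1 / (1 - w)) = - (z / 2 * (2 * z / (z\<^sup>2 - of_nat n ^ 2)))"
      using \<open>w \<noteq> 1\<close> that by (simp add: w_def field_simps power2_eq_square)
    ultimately show ?thesis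
      by (simp add: has_sum_pos_nat_iff f_def w_def power_mult)
  qed
  \<comment> \<open>This product family dominates \<open>f\<close>, since \<open>n ^ (2 * j)\<close>
    is at least \<open>n ^ 2\<close> for \<open>j > 0\<close>; hence the restriction to positive
    \<open>j\<close>.\<close>
  have "(\<lambda>(n, j). norm (1 / of_nat n ^ 2 * z ^ (2 * j))) summable_on {0<..} \<times> {0<..}"
  proof (intro norm_summable_on_Times_product inverse_power_norm_summable)
    have "summable (\<lambda>j. norm (z ^ 2) ^ j)"
      using assms by (intro summable_geometric) (simp add: norm_power power_less_one_iff)
    hence "summable (\<lambda>j. norm (z ^ (2 * j)))"
      by (simp add: power_mult norm_power)
    thus "(\<lambda>j. norm (z ^ (2 * j))) summable_on {0<..}"
      by (intro summable_on_subset_banach[OF norm_summable_imp_summable_on]) auto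
  qed auto
  hence "(\<lambda>(n, j). norm (f n j)) summable_on {0<..} \<times> {0<..}"
  proof (rule summable_on_comparison_test, safe)
    fix n j :: nat assume "n > 0" "j > 0"
    have "norm (f n j) = norm z ^ (2 * j) * (1 / real n ^ (2 * j))"
      by (simp add: f_def norm_power norm_divide power_divide)
    also have "\<dots> \<le> norm z ^ (2 * j) * (1 / real n ^ 2)"
      using \<open>n > 0\<close> \<open>j > 0\<close> by (intro mult_left_mono divide_left_mono power_increasing) auto
    finally show "norm (f n j) \<le> norm (1 / of_nat n ^ 2 * z ^ (2 * j))"
      by (simp add: norm_mult norm_power norm_divide mult.commute)
  qed auto
  hence "(\<lambda>(n, j). f n j) summable_on {0<..} \<times> {0<..}"
    by - (rule abs_summable_summable, simp add: case_prod_unfold)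
  hence sm: "(\<lambda>(j, n). f n j) summable_on {0<..} \<times> {0<..}"
    using summable_on_swap[of "\<lambda>(n, j). f n j" "{0<..}" "{0<..}"] by simp
  hence "((\<lambda>j. \<Sum>\<^sub>\<infinity>n\<in>{0<..}. f n j) has_sum infsum (\<lambda>(j, n). f n j) ({0<..} \<times> {0<..})) {0<..}"
    by (intro has_sum_SigmaD[OF has_sum_infsum]) 
       (auto intro!: has_sum_infsum summable_on_SigmaD1[where f = "\<lambda>j n. f n j"])
  also have "infsum (\<lambda>(j, n). f n j) ({0<..} \<times> {0<..}) = infsum (\<lambda>n. infsum (f n) {0<..}) {0<..}"
    using sm by (simp add: infsum_Sigma'_banach [symmetric] infsum_swap_banach)
  also have "\<dots> = (\<Sum>\<^sub>\<infinity>n\<in>{0<..}. - (z / 2) * (2 * z / (z\<^sup>2 - of_nat n ^ 2)))"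
    by (intro infsum_cong infsumI) (use geo in auto)
  also have "\<dots> = - (z / 2) * (of_real pi * cot (of_real pi * z) - 1 / z)"
    using cot_partial_fractions_has_sum[OF \<open>z \<notin> \<int>\<close>] by (intro infsumI has_sum_cmult_right)
  finally have "((\<lambda>j. \<Sum>\<^sub>\<infinity>n\<in>{0<..}. f n j) has_sum
                  - (z / 2) * (of_real pi * cot (of_real pi * z) - 1 / z)) {0<..}" .
  also have "(\<lambda>j. \<Sum>\<^sub>\<infinity>n\<in>{0<..}. f n j) = (\<lambda>j. (\<Sum>\<^sub>\<infinity>n\<in>{0<..}. 1 / of_nat n ^ (2 * j)) * z ^ (2 * j))"
    by (simp add: f_def power_divide infsum_cmult_left' [symmetric])
  finally have "(\<lambda>j. zeta_even (Suc j) * z ^ (2 * Suc j)) sums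
                  (- (z / 2) * (of_real pi * cot (of_real pi * z) - 1 / z))"
    unfolding has_sum_pos_nat_iff by (intro has_sum_imp_sums) (simp add: zeta_even_def)
  \<comment> \<open>The term \<open>- 1 / 2\<close> at \<open>j = 0\<close> cancels the contribution
    of \<open>1 / z\<close>.\<close>
  hence "(\<lambda>j. zeta_even j * z ^ (2 * j)) sums
           (- (z / 2) * (of_real pi * cot (of_real pi * z) - 1 / z) + zeta_even 0)"
    by (subst (asm) sums_Suc_iff) simp
  thus ?thesis
    using assms by (simp add: zeta_even_def field_simps)
qed

text \<open>The substitution of \<open>c * X\<close> for \<open>X\<close> in the real identity
  \<open>bernoulli_fps\<close>, carried out by multiplying the coefficient at \<open>n\<close> by
  \<open>c ^ n\<close>.\<close>

lemma bernoulli_fps_scaled: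
  fixes c :: complex
  shows "Abs_fps (\<lambda>m. of_real (bernoulli m / fact m) * c ^ m) * (fps_exp c - 1) = fps_const c * fps_X"
proof (rule fps_ext)
  fix n
  have "(\<Sum>i=0..n. (bernoulli i / fact i) * fps_nth (fps_exp 1 - 1) (n - i)) = fps_nth fps_X n"
    by (subst bernoulli_fps [symmetric]) (simp add: fps_mult_nth)
  hence "of_real (\<Sum>i=0..n. (bernoulli i / fact i) * fps_nth (fps_exp 1 - 1) (n - i)) * c ^ n =
           of_real (fps_nth fps_X n) * c ^ n"
    by simp
  hence "(\<Sum>i=0..n. of_real (bernoulli i / fact i * fps_nth (fps_exp 1 - 1) (n - i)) * c ^ n) =
           of_real (fps_nth fps_X n) * c ^ n"
    by (simp only: of_real_sum sum_distrib_right)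
  also have "(\<Sum>i=0..n. of_real (bernoulli i / fact i * fps_nth (fps_exp 1 - 1) (n - i)) * c ^ n) =
      (\<Sum>i=0..n. of_real (bernoulli i / fact i) * c ^ i * fps_nth (fps_exp c - 1) (n - i))"
  proof (rule sum.cong)
    fix i assume "i \<in> {0..n}"
    hence "c ^ n = c ^ i * c ^ (n - i)" by (simp flip: power_add)
    moreover have "fps_nth (fps_exp c - 1) (n - i) =
                     of_real (fps_nth (fps_exp 1 - 1) (n - i)) * c ^ (n - i)"
      by auto
    ultimately show "of_real (bernoulli i / fact i * fps_nth (fps_exp 1 - 1) (n - i)) * c ^ n =
        of_real (bernoulli i / fact i) * c ^ i * fps_nth (fps_exp c - 1) (n - i)"
      by (simp only: of_real_mult mult_ac)
  qed auto
  also have "of_real (fps_nth fps_X n) * c ^ n = fps_nth (fps_const c * fps_X) n"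
    by (cases "n = 1") auto
  finally show "fps_nth (Abs_fps (\<lambda>m. of_real (bernoulli m / fact m) * c ^ m) * (fps_exp c - 1)) n =
                  fps_nth (fps_const c * fps_X) n"
    by (simp only: fps_mult_nth[of "Abs_fps _"] fps_nth_Abs_fps)
qed

text \<open>Euler's evaluation. With \<open>c = 2 * pi * \<i>\<close>, the cotangent in exponential
  form gives \<open>- 2 * h u = c * u / 2 + c * u / (exp (c * u) - 1)\<close>. The last term
  generates the Bernoulli numbers, and the linear term does not affect even coefficients.\<close>

lemma zeta_even_bernoulli:
  "zeta_even j = - (of_real (bernoulli (2 * j) / fact (2 * j)) * (2 * of_real pi * \<i>) ^ (2 * j)) / 2"
proof -
  define c where "c = 2 * of_real pi * \<i>"
  define F where "F = Abs_fps (\<lambda>m. if even m then zeta_even (m div 2) else 0)"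
  define B where "B = Abs_fps (\<lambda>m. of_real (bernoulli m / fact m) * c ^ m)"
  define h where "h = (\<lambda>u. if u = 0 then - 1 / 2 else - (of_real pi * u * cot (of_real pi * u)) / 2 :: complex)"
  have h: "h has_fps_expansion F"
  proof (rule has_fps_expansionI)
    have "eventually (\<lambda>u::complex. u \<in> ball 0 1) (nhds 0)"
      by (intro eventually_nhds_in_open) auto
    thus "eventually (\<lambda>u. (\<lambda>n. fps_nth F n * u ^ n) sums h u) (nhds 0)"
    proof eventually_elim
      case (elim u)
      have "(\<lambda>j. zeta_even j * u ^ (2 * j)) sums h u"
      proof (cases "u = 0")
        case True
        have "(\<lambda>j. zeta_even j * u ^ (2 * j)) sums (\<Sum>j\<in>{0}. zeta_even j * u ^ (2 * j))"
          using True by (intro sums_finite) auto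
        thus ?thesis using True by (simp add: h_def zeta_even_def)
      next
        case False
        thus ?thesis using zeta_even_cot[of u] elim by (simp add: h_def)
      qed
      hence "(\<lambda>j. fps_nth F (2 * j) * u ^ (2 * j)) sums h u"
        by (simp add: F_def)
      thus ?case
        by (subst (asm) sums_mono_reindex) (auto simp: F_def strict_mono_def elim!: evenE)
    qed
  qed
  have lhs: "(\<lambda>u. h u * (exp (c * u) - 1)) has_fps_expansion F * (fps_exp c - 1)"
    by (intro fps_expansion_intros h)
  have rhs: "(\<lambda>u. - (c / 4) * (u * (exp (c * u) + 1))) has_fps_expansion
               fps_const (- (c / 4)) * (fps_X * (fps_exp c + 1))"
    by (intro fps_expansion_intros)
  have "h u * (exp (c * u) - 1) = - (c / 4) * (u * (exp (c * u) + 1))" if "norm u < 1" for u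
  proof (cases "u = 0")
    case False
    define x where "x = of_real pi * u"
    have "sin x \<noteq> 0"
    proof
      assume "sin x = 0"
      then obtain n :: int where "x = of_int n * of_real pi"
        by (auto simp: sin_eq_0)
      hence "u = of_int n" by (simp add: x_def)
      thus False using that False by simp
    qed
    have "exp (c * u) - 1 = exp (\<i> * x) * (2 * \<i> * sin x)"
      by (simp add: sin_exp_eq x_def c_def field_simps flip: exp_add)
    moreover have "exp (c * u) + 1 = exp (\<i> * x) * (2 * cos x)"
      by (simp add: cos_exp_eq x_def c_def field_simps flip: exp_add)
    ultimately show ?thesis
      using False \<open>sin x \<noteq> 0\<close> by (simp add: h_def c_def cot_def flip: x_def)
  qed (simp add: h_def)
  hence ev: "eventually (\<lambda>u. h u * (exp (c * u) - 1) = - (c / 4) * (u * (exp (c * u) + 1))) (nhds 0)"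
    by (intro eventually_mono[OF eventually_nhds_in_open[of "ball 0 1"]]) auto
  \<comment> \<open>Both formal series now expand one and the same function near \<open>0\<close>,
    so their coefficients agree.\<close>
  have "eventually (\<lambda>u. eval_fps (F * (fps_exp c - 1)) u = - (c / 4) * (u * (exp (c * u) + 1))) (nhds 0)"
    using ev lhs[unfolded has_fps_expansion_def, THEN conjunct2] by eventually_elim simp
  hence lhs': "(\<lambda>u. - (c / 4) * (u * (exp (c * u) + 1))) has_fps_expansion F * (fps_exp c - 1)"
    using lhs unfolding has_fps_expansion_def by blast
  have "F * (fps_exp c - 1) = fps_const (- (c / 4)) * (fps_X * (fps_exp c + 1))"
    by (rule fps_ext) (simp only: fps_nth_fps_expansion[OF lhs'] fps_nth_fps_expansion[OF rhs])
  \<comment> \<open>Because \<open>exp (c * u) + 1\<close> exceeds \<open>exp (c * u) - 1\<close> by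
    \<open>2\<close>, subtracting the linear term leaves exactly \<open>c * X\<close>. The factor
    \<open>fps_exp c - 1\<close> is cancelled only at the end.\<close>
  hence "(fps_const (- 2) * F - fps_const (c / 2) * fps_X) * (fps_exp c - 1) =
      (fps_const (- 2) * fps_const (- (c / 4))) * (fps_X * (fps_exp c + 1)) -
      fps_const (c / 2) * fps_X * (fps_exp c - 1)"
    by (simp only: left_diff_distrib mult.assoc)
  also have "fps_const (- 2) * fps_const (- (c / 4)) = fps_const (c / 2)"
    by simp
  also have "fps_const (c / 2) * (fps_X * (fps_exp c + 1)) - fps_const (c / 2) * fps_X * (fps_exp c - 1) =
               (fps_const (c / 2) + fps_const (c / 2)) * fps_X"
    by (simp only: ring_distribs mult.assoc mult_1_right) algebra
  also have "fps_const (c / 2) + fps_const (c / 2) = fps_const c"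
    by simp
  also have "fps_const c * fps_X = B * (fps_exp c - 1)"
    using bernoulli_fps_scaled[of c] by (simp add: B_def)
  finally have eq: "(fps_const (- 2) * F - fps_const (c / 2) * fps_X) * (fps_exp c - 1) = B * (fps_exp c - 1)" .
  have "fps_nth (fps_exp c - 1) 1 \<noteq> 0"
    by (simp add: c_def)
  hence "fps_exp c - 1 \<noteq> 0" by (metis fps_zero_nth)
  hence "fps_nth (fps_const (- 2) * F - fps_const (c / 2) * fps_X) (2 * j) = fps_nth B (2 * j)"
    using eq by simp
  moreover have "fps_nth (fps_const (c / 2) * fps_X) (2 * j) = 0"
    by (simp only: fps_mult_left_const_nth fps_X_nth) simp
  ultimately have *: "- 2 * zeta_even j = of_real (bernoulli (2 * j) / fact (2 * j)) * c ^ (2 * j)"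
    by (simp only: fps_sub_nth fps_mult_left_const_nth F_def B_def fps_nth_Abs_fps) simp
  have "zeta_even j = - (- 2 * zeta_even j) / 2" by simp
  thus ?thesis
    unfolding * by (simp only: c_def)
qed

section \<open>The inversion formula for the cotangent sum\<close>

lemma lattice_summable:
  fixes f :: "nat \<Rightarrow> nat \<Rightarrow> complex"
  assumes "\<And>n m. n > 0 \<Longrightarrow> m > 0 \<Longrightarrow> norm (f n m) \<le> C / (real n ^ 2 * real m ^ 2)"
  shows "(\<lambda>(n, m). f n m) summable_on {0<..} \<times> {0<..}"
proof -
  have "(\<lambda>(n, m). norm (1 / of_nat n ^ 2 * (1 / of_nat m ^ 2) :: complex)) summable_on {0<..} \<times> {0<..}"
    by (intro norm_summable_on_Times_product inverse_power_norm_summable) auto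
  hence "(\<lambda>p. C * (case p of (n, m) \<Rightarrow> norm (1 / of_nat n ^ 2 * (1 / of_nat m ^ 2) :: complex)))
           summable_on {0<..} \<times> {0<..}"
    by (rule summable_on_cmult_right)
  hence "(\<lambda>(n, m). norm (f n m)) summable_on {0<..} \<times> {0<..}"
  proof (rule summable_on_comparison_test, safe)
    fix n m :: nat assume "n > 0" "m > 0"
    thus "norm (f n m) \<le> C * norm (1 / of_nat n ^ 2 * (1 / of_nat m ^ 2) :: complex)"
      using assms[of n m] by (simp add: norm_mult norm_divide norm_power)
  qed auto
  thus ?thesis
    by - (rule abs_summable_summable, simp add: case_prod_unfold)
qed

text \<open>The difference of squares factors into \<open>n * \<tau> + m\<close> and
  \<open>n * \<tau> - m\<close>. After multiplication by \<open>cnj \<tau>\<close> each factor has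
  an imaginary part of size \<open>m * \<bar>Im \<tau>\<bar>\<close>, so the bound is uniform in
  \<open>n\<close>.\<close>

lemma norm_lattice_diff_ge:
  assumes "Im \<tau> \<noteq> 0"
  shows "norm ((of_nat n * \<tau>)\<^sup>2 - of_nat m ^ 2) \<ge> (Im \<tau> / norm \<tau>)\<^sup>2 * real m ^ 2"
proof -
  have *: "\<bar>Im \<tau>\<bar> * real m \<le> norm (of_nat n * \<tau> + of_int k) * norm \<tau>" if "\<bar>k\<bar> = int m" for k
  proof -
    have "Im ((of_nat n * \<tau> + of_int k) * cnj \<tau>) = - of_int k * Im \<tau>"
      by (simp add: algebra_simps)
    hence "\<bar>Im ((of_nat n * \<tau> + of_int k) * cnj \<tau>)\<bar> = \<bar>Im \<tau>\<bar> * real m"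
      using that by (simp add: abs_mult flip: of_int_abs)
    thus ?thesis
      using abs_Im_le_cmod[of "(of_nat n * \<tau> + of_int k) * cnj \<tau>"] by (simp add: norm_mult)
  qed
  have "(\<bar>Im \<tau>\<bar> * real m) * (\<bar>Im \<tau>\<bar> * real m) \<le>
          (norm (of_nat n * \<tau> + of_int (int m)) * norm \<tau>) * (norm (of_nat n * \<tau> + of_int (- int m)) * norm \<tau>)"
    by (intro mult_mono *) auto
  also have "\<dots> = norm ((of_nat n * \<tau> + of_int (int m)) * (of_nat n * \<tau> + of_int (- int m))) * norm \<tau> ^ 2"
    by (simp add: norm_mult power2_eq_square)
  also have "(of_nat n * \<tau> + of_int (int m)) * (of_nat n * \<tau> + of_int (- int m)) =
               (of_nat n * \<tau>)\<^sup>2 - of_nat m ^ 2"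
    by (simp add: power2_eq_square algebra_simps)
  finally have "(\<bar>Im \<tau>\<bar> * real m) * (\<bar>Im \<tau>\<bar> * real m) / norm \<tau> ^ 2 \<le>
      norm ((of_nat n * \<tau>)\<^sup>2 - of_nat m ^ 2)"
    using assms by (subst pos_divide_le_eq) auto
  thus ?thesis
    by (simp add: power2_eq_square mult_ac)
qed

lemma has_sum_inverse_square_diff:
  assumes "z \<notin> \<int>"
  shows "((\<lambda>m. 1 / (z\<^sup>2 - of_nat m ^ 2)) has_sum
           ((of_real pi * cot (of_real pi * z) - 1 / z) / (2 * z) :: complex)) {0<..}"
proof -
  have "z \<noteq> 0" using assms by auto
  thus ?thesis
    using has_sum_cmult_right[OF cot_partial_fractions_has_sum[OF assms], of "1 / (2 * z)"]
    by (simp add: field_simps)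
qed

lemma zeta_even_has_sum:
  assumes "j > 0"
  shows "((\<lambda>n. 1 / of_nat n ^ (2 * j)) has_sum zeta_even j) {0<..}"
  using assms inverse_power_norm_summable[of "2 * j"]
  by (auto simp: zeta_even_def intro!: has_sum_infsum abs_summable_summable[of "\<lambda>n. 1 / of_nat n ^ (2 * j)"])

lemma has_sum_sum:
  fixes f :: "'i \<Rightarrow> 'a \<Rightarrow> 'b :: topological_comm_monoid_add"
  assumes "\<And>i. i \<in> I \<Longrightarrow> (f i has_sum S i) A"
  shows "((\<lambda>x. \<Sum>i\<in>I. f i x) has_sum (\<Sum>i\<in>I. S i)) A"
  using assms by (induction I rule: infinite_finite_induct) (auto intro!: has_sum_add)

text \<open>For odd \<open>s \<ge> 3\<close> it converges in both open half planes. This matters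
  because \<open>1 / \<tau>\<close> lies in the opposite one; oddness brings the argument
  back.\<close>

definition cot_sum :: "nat \<Rightarrow> complex \<Rightarrow> complex" where
  "cot_sum s \<tau> = (\<Sum>\<^sub>\<infinity>n\<in>{0<..}. cot (of_real pi * (of_nat n * \<tau>)) / of_nat n ^ s)"

text \<open>Summing over \<open>m\<close> first yields a cotangent by partial fractions, and the
  corrections \<open>1 / (n * \<tau>)\<close> add up to \<open>zeta_even (N + 1)\<close>.
  Convergence of the cotangent sum is inherited from the absolutely convergent double series, so
  both claims share one proof.\<close>

lemma
  assumes "Im \<tau> \<noteq> 0" "N \<ge> 1"
  shows cot_sum_has_sum:
          "((\<lambda>n. cot (of_real pi * (of_nat n * \<tau>)) / of_nat n ^ (2 * N + 1)) has_sum cot_sum (2 * N + 1) \<tau>) {0<..}"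
    and cot_sum_double_series:
          "((\<lambda>(n, m). 1 / (of_nat n ^ (2 * N) * ((of_nat n * \<tau>)\<^sup>2 - of_nat m ^ 2))) has_sum
              (of_real pi * cot_sum (2 * N + 1) \<tau> - zeta_even (N + 1) / \<tau>) / (2 * \<tau>)) ({0<..} \<times> {0<..})"
proof -
  define f where "f = (\<lambda>n m. 1 / (of_nat n ^ (2 * N) * ((of_nat n * \<tau>)\<^sup>2 - of_nat m ^ 2)))"
  define S where "S = infsum (\<lambda>(n, m). f n m) ({0<..} \<times> {0<..})"
  have [simp]: "\<tau> \<noteq> 0" using assms by auto
  have "(\<lambda>(n, m). f n m) summable_on {0<..} \<times> {0<..}"
  proof (rule lattice_summable)
    fix n m :: nat assume nm: "n > 0" "m > 0"
    have "real n ^ 2 * ((Im \<tau> / norm \<tau>)\<^sup>2 * real m ^ 2) \<le>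
            real n ^ (2 * N) * norm ((of_nat n * \<tau>)\<^sup>2 - of_nat m ^ 2)"
      using nm assms by (intro mult_mono power_increasing norm_lattice_diff_ge) auto
    moreover have "real n ^ 2 * ((Im \<tau> / norm \<tau>)\<^sup>2 * real m ^ 2) > 0"
      using nm assms by simp
    ultimately have "norm (f n m) \<le> 1 / (real n ^ 2 * ((Im \<tau> / norm \<tau>)\<^sup>2 * real m ^ 2))"
      unfolding f_def norm_divide norm_mult norm_power norm_of_nat norm_one by (intro frac_le) auto
    thus "norm (f n m) \<le> (norm \<tau> / Im \<tau>)\<^sup>2 / (real n ^ 2 * real m ^ 2)"
      by (simp add: power_divide mult_ac)
  qed
  hence S: "((\<lambda>(n, m). f n m) has_sum S) ({0<..} \<times> {0<..})"
    unfolding S_def by (rule has_sum_infsum)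
  have inner: "(f n has_sum 1 / of_nat n ^ (2 * N) *
      ((of_real pi * cot (of_real pi * (of_nat n * \<tau>)) - 1 / (of_nat n * \<tau>)) / (2 * (of_nat n * \<tau>)))) {0<..}"
    if "n > 0" for n
  proof -
    have "of_nat n * \<tau> \<notin> \<int>"
      using assms that by (auto elim!: Ints_cases simp: complex_eq_iff)
    from has_sum_cmult_right[OF has_sum_inverse_square_diff[OF this], of "1 / of_nat n ^ (2 * N)"]
    show ?thesis by (simp add: f_def)
  qed
  have "((\<lambda>n. 1 / of_nat n ^ (2 * N) *
      ((of_real pi * cot (of_real pi * (of_nat n * \<tau>)) - 1 / (of_nat n * \<tau>)) / (2 * (of_nat n * \<tau>))))
      has_sum S) {0<..}"
    using has_sum_SigmaD[OF S] inner by simp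
  hence "((\<lambda>n. 2 * \<tau> * (1 / of_nat n ^ (2 * N) *
      ((of_real pi * cot (of_real pi * (of_nat n * \<tau>)) - 1 / (of_nat n * \<tau>)) / (2 * (of_nat n * \<tau>)))) +
      1 / \<tau> * (1 / of_nat n ^ (2 * (N + 1))))
      has_sum (2 * \<tau> * S + 1 / \<tau> * zeta_even (N + 1))) {0<..}"
    by (intro has_sum_add has_sum_cmult_right zeta_even_has_sum) auto
  also have "?this \<longleftrightarrow> ((\<lambda>n. of_real pi * (cot (of_real pi * (of_nat n * \<tau>)) / of_nat n ^ (2 * N + 1)))
      has_sum (2 * \<tau> * S + 1 / \<tau> * zeta_even (N + 1))) {0<..}"
  proof (intro has_sum_cong)
    fix n :: nat assume "n \<in> {0<..}"
    have "2 * \<tau> * (1 / W * ((p - 1 / (w * \<tau>)) / (2 * (w * \<tau>)))) + 1 / \<tau> * (1 / (W * w * w)) = p / (W * w)"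
      if "w \<noteq> 0" "W \<noteq> 0" for w W p :: complex
      using that by (simp add: divide_simps)
    from this[of "of_nat n" "of_nat n ^ (2 * N)" "of_real pi * cot (of_real pi * (of_nat n * \<tau>))"]
    show "2 * \<tau> * (1 / of_nat n ^ (2 * N) * ((of_real pi * cot (of_real pi * (of_nat n * \<tau>)) -
        1 / (of_nat n * \<tau>)) / (2 * (of_nat n * \<tau>)))) + 1 / \<tau> * (1 / of_nat n ^ (2 * (N + 1))) =
        of_real pi * (cot (of_real pi * (of_nat n * \<tau>)) / of_nat n ^ (2 * N + 1))"
      using \<open>n \<in> {0<..}\<close> by (simp add: mult_ac power_add)
  qed
  finally have "((\<lambda>n. 1 / of_real pi * (of_real pi * (cot (of_real pi * (of_nat n * \<tau>)) / of_nat n ^ (2 * N + 1))))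
      has_sum (1 / of_real pi * (2 * \<tau> * S + 1 / \<tau> * zeta_even (N + 1)))) {0<..}"
    by (rule has_sum_cmult_right)
  hence *: "((\<lambda>n. cot (of_real pi * (of_nat n * \<tau>)) / of_nat n ^ (2 * N + 1))
      has_sum (1 / of_real pi * (2 * \<tau> * S + 1 / \<tau> * zeta_even (N + 1)))) {0<..}"
    by simp
  from infsumI[OF this] have eq: "cot_sum (2 * N + 1) \<tau> = 1 / of_real pi * (2 * \<tau> * S + 1 / \<tau> * zeta_even (N + 1))"
    by (simp add: cot_sum_def)
  show "((\<lambda>n. cot (of_real pi * (of_nat n * \<tau>)) / of_nat n ^ (2 * N + 1)) has_sum cot_sum (2 * N + 1) \<tau>) {0<..}"
    using * by (simp only: eq)
  have "S = (of_real pi * cot_sum (2 * N + 1) \<tau> - zeta_even (N + 1) / \<tau>) / (2 * \<tau>)"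
    unfolding eq by (simp add: field_simps)
  thus "((\<lambda>(n, m). 1 / (of_nat n ^ (2 * N) * ((of_nat n * \<tau>)\<^sup>2 - of_nat m ^ 2))) has_sum
              (of_real pi * cot_sum (2 * N + 1) \<tau> - zeta_even (N + 1) / \<tau>) / (2 * \<tau>)) ({0<..} \<times> {0<..})"
    using S by (simp add: f_def)
qed

text \<open>Induction with \<open>1 / (x * (x - y)) = (1 / (x - y) - 1 / x) / y\<close>, which
  trades one factor \<open>x\<close> for a factor \<open>y\<close>. It exchanges the roles of
  \<open>x\<close> and \<open>y\<close> up to terms in which the variables separate.\<close>

lemma inverse_power_partial_fractions:
  fixes x y :: complex
  assumes "x \<noteq> 0" "y \<noteq> 0" "x \<noteq> y"
  shows "1 / (x ^ N * (x - y)) = 1 / (y ^ N * (x - y)) - (\<Sum>i=1..N. 1 / (x ^ i * y ^ (N + 1 - i)))"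
proof (induction N)
  case (Suc N)
  have "(\<Sum>i=1..N. 1 / (x ^ i * y ^ (N + 2 - i))) = (\<Sum>i=1..N. 1 / (x ^ i * y ^ (N + 1 - i))) / y"
    unfolding sum_divide_distrib
    by (intro sum.cong) (auto simp: Suc_diff_le)
  hence "(\<Sum>i=1..Suc N. 1 / (x ^ i * y ^ (Suc N + 1 - i))) =
           (1 / (y ^ N * (x - y)) - 1 / (x ^ N * (x - y))) / y + 1 / (x ^ Suc N * y)"
    using Suc.IH by simp
  also have "\<dots> = 1 / (y ^ Suc N * (x - y)) - 1 / (x ^ Suc N * (x - y))"
    using assms by (simp add: divide_simps) (simp add: algebra_simps)
  finally show ?case by simp
qed auto

text \<open>Summing the partial fraction decomposition of \<open>1 / (x\<^sup>N (x - y))\<close> over \<open>x = (n \<tau>)\<^sup>2\<close> and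
  \<open>y = m\<^sup>2\<close>: all the double series converge absolutely, so no limit is taken outside the
  domain of Fubini's theorem.\<close>
theorem cot_sum_transformation:
  assumes \<tau>: "Im \<tau> \<noteq> 0" and N: "N \<ge> 1"
  shows "of_real pi * (cot_sum (2 * N + 1) \<tau> + \<tau> ^ (2 * N) * cot_sum (2 * N + 1) (1 / \<tau>)) =
           - 2 * (\<Sum>j=0..N+1. \<tau> powi (2 * int N + 1 - 2 * int j) * (zeta_even j * zeta_even (N + 1 - j)))"
proof -
  have [simp]: "\<tau> \<noteq> 0" using \<tau> by auto
  have "Im (1 / \<tau>) \<noteq> 0" using \<tau> by (simp add: Im_divide)
  define T1 where "T1 = (of_real pi * cot_sum (2 * N + 1) \<tau> - zeta_even (N + 1) / \<tau>) / (2 * \<tau>)"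
  define T2 where "T2 = (of_real pi * cot_sum (2 * N + 1) (1 / \<tau>) - zeta_even (N + 1) / (1 / \<tau>)) / (2 * (1 / \<tau>))"
  define x where "x = (\<lambda>n. (of_nat n * \<tau>)\<^sup>2)"
  define y :: "nat \<Rightarrow> complex" where "y = (\<lambda>n. of_nat n ^ 2)"
  have T1: "((\<lambda>(n, m). 1 / \<tau> ^ (2 * N) * (1 / (of_nat n ^ (2 * N) * ((of_nat n * \<tau>)\<^sup>2 - of_nat m ^ 2)))) has_sum
               1 / \<tau> ^ (2 * N) * T1) ({0<..} \<times> {0<..})"
    using has_sum_cmult_right[OF cot_sum_double_series[OF \<tau> N], of "1 / \<tau> ^ (2 * N)"]
    unfolding T1_def case_prod_unfold .
  \<comment> \<open>The series for \<open>1 / \<tau>\<close> with its indices swapped represents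
    \<open>1 / (y ^ N * (x - y))\<close>; the factor \<open>- 1 / \<tau>\<^sup>2\<close> comes from
    \<open>x - y = - \<tau>\<^sup>2 * ((m / \<tau>)\<^sup>2 - n\<^sup>2)\<close>.\<close>
  have "((\<lambda>(m, n). 1 / (of_nat m ^ (2 * N) * ((of_nat m * (1 / \<tau>))\<^sup>2 - of_nat n ^ 2))) has_sum T2) ({0<..} \<times> {0<..})"
    unfolding T2_def by (rule cot_sum_double_series) fact+
  from has_sum_cmult_right[OF has_sum_swap[THEN iffD1, OF this], of "- 1 / \<tau>\<^sup>2"]
  have T2: "((\<lambda>(n, m). - 1 / \<tau>\<^sup>2 * (1 / (of_nat m ^ (2 * N) * ((of_nat m * (1 / \<tau>))\<^sup>2 - of_nat n ^ 2)))) has_sum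
               - 1 / \<tau>\<^sup>2 * T2) ({0<..} \<times> {0<..})"
    by (simp add: case_prod_unfold)
  have Z: "((\<lambda>(n, m). 1 / \<tau> ^ (2 * i) * (1 / of_nat n ^ (2 * i) * (1 / of_nat m ^ (2 * (N + 1 - i))))) has_sum
              1 / \<tau> ^ (2 * i) * (zeta_even i * zeta_even (N + 1 - i))) ({0<..} \<times> {0<..})" if "i \<in> {1..N}" for i
  proof -
    have "((\<lambda>(n, m). 1 / of_nat n ^ (2 * i) * (1 / of_nat m ^ (2 * (N + 1 - i)))) has_sum
            infsum (\<lambda>n. 1 / of_nat n ^ (2 * i) :: complex) {0<..} *
            infsum (\<lambda>n. 1 / of_nat n ^ (2 * (N + 1 - i)) :: complex) {0<..}) ({0<..} \<times> {0<..})"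
      using that by (intro has_sum_Times_product inverse_power_norm_summable) auto
    from has_sum_cmult_right[OF this, of "1 / \<tau> ^ (2 * i)"] show ?thesis
      using that by (simp add: zeta_even_def case_prod_unfold)
  qed
  have "((\<lambda>(n, m). \<Sum>i=1..N. 1 / \<tau> ^ (2 * i) * (1 / of_nat n ^ (2 * i) * (1 / of_nat m ^ (2 * (N + 1 - i))))) has_sum
          (\<Sum>i=1..N. 1 / \<tau> ^ (2 * i) * (zeta_even i * zeta_even (N + 1 - i)))) ({0<..} \<times> {0<..})"
    using Z unfolding case_prod_unfold by (rule has_sum_sum)
  from has_sum_add[OF T2 has_sum_cmult_right[OF this, of "- 1"]]
  have "((\<lambda>(n, m). 1 / \<tau> ^ (2 * N) * (1 / (of_nat n ^ (2 * N) * ((of_nat n * \<tau>)\<^sup>2 - of_nat m ^ 2)))) has_sum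
          (- 1 / \<tau>\<^sup>2 * T2 + - 1 * (\<Sum>i=1..N. 1 / \<tau> ^ (2 * i) * (zeta_even i * zeta_even (N + 1 - i))))) ({0<..} \<times> {0<..})"
  proof (rule has_sum_cong[THEN iffD1, rotated], safe, goal_cases)
    case (1 n m)
    hence nz: "x n \<noteq> 0" "y m \<noteq> 0" by (auto simp: x_def y_def)
    have "(Im \<tau> / norm \<tau>)\<^sup>2 * real m ^ 2 > 0" using 1 \<tau> by simp
    hence "norm (x n - y m) > 0"
      using norm_lattice_diff_ge[OF \<tau>, of m n] unfolding x_def y_def by linarith
    hence "x n \<noteq> y m" by auto
    have "1 / \<tau> ^ (2 * N) * (1 / (of_nat n ^ (2 * N) * ((of_nat n * \<tau>)\<^sup>2 - of_nat m ^ 2))) =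
            1 / (x n ^ N * (x n - y m))"
      by (simp add: x_def y_def power_mult_distrib flip: power_mult)
    also have "\<dots> = 1 / (y m ^ N * (x n - y m)) - (\<Sum>i=1..N. 1 / (x n ^ i * y m ^ (N + 1 - i)))"
      by (rule inverse_power_partial_fractions) fact+
    also have "(\<Sum>i=1..N. 1 / (x n ^ i * y m ^ (N + 1 - i))) =
        (\<Sum>i=1..N. 1 / \<tau> ^ (2 * i) * (1 / of_nat n ^ (2 * i) * (1 / of_nat m ^ (2 * (N + 1 - i)))))"
      by (simp add: x_def y_def power_mult_distrib mult_ac flip: power_mult)
    also have "1 / (y m ^ N * (x n - y m)) =
        - 1 / \<tau>\<^sup>2 * (1 / (of_nat m ^ (2 * N) * ((of_nat m * (1 / \<tau>))\<^sup>2 - of_nat n ^ 2)))"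
    proof -
      have "x n - y m = - (\<tau>\<^sup>2 * ((of_nat m * (1 / \<tau>))\<^sup>2 - of_nat n ^ 2))"
        by (simp add: x_def y_def field_simps)
      thus ?thesis by (simp add: y_def mult_ac flip: power_mult)
    qed
    finally show ?case by simp
  qed
  hence "1 / \<tau> ^ (2 * N) * T1 =
      - 1 / \<tau>\<^sup>2 * T2 + - 1 * (\<Sum>i=1..N. 1 / \<tau> ^ (2 * i) * (zeta_even i * zeta_even (N + 1 - i)))"
    using T1 has_sum_unique by blast
  hence "2 * \<tau> ^ (2 * N + 1) * (1 / \<tau> ^ (2 * N) * T1) =
      2 * \<tau> ^ (2 * N + 1) * (- 1 / \<tau>\<^sup>2 * T2 - (\<Sum>i=1..N. 1 / \<tau> ^ (2 * i) * (zeta_even i * zeta_even (N + 1 - i))))"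
    by simp
  also have "\<dots> = 2 * \<tau> ^ (2 * N + 1) * (- 1 / \<tau>\<^sup>2 * T2) -
      2 * (\<Sum>i=1..N. \<tau> powi (2 * int N + 1 - 2 * int i) * (zeta_even i * zeta_even (N + 1 - i)))"
  proof -
    have pow: "\<tau> ^ (2 * N + 1) * (1 / \<tau> ^ (2 * i)) = \<tau> powi (2 * int N + 1 - 2 * int i)" for i
    proof -
      have "\<tau> powi (int (2 * N + 1) - int (2 * i)) = \<tau> powi int (2 * N + 1) / \<tau> powi int (2 * i)"
        by (rule power_int_diff) simp
      moreover have "2 * int N + 1 - 2 * int i = int (2 * N + 1) - int (2 * i)"
        by simp
      ultimately show ?thesis by (simp only: power_int_of_nat) simp
    qed
    have "\<tau> ^ (2 * N + 1) * (\<Sum>i=1..N. 1 / \<tau> ^ (2 * i) * (zeta_even i * zeta_even (N + 1 - i))) =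
        (\<Sum>i=1..N. \<tau> powi (2 * int N + 1 - 2 * int i) * (zeta_even i * zeta_even (N + 1 - i)))"
      unfolding sum_distrib_left by (intro sum.cong refl) (simp only: mult.assoc [symmetric] pow)
    thus ?thesis
      by (simp only: right_diff_distrib mult.assoc)
  qed
  also have "2 * \<tau> ^ (2 * N + 1) * (- 1 / \<tau>\<^sup>2 * T2) =
      \<tau> ^ (2 * N + 1) * zeta_even (N + 1) - \<tau> ^ (2 * N) * (of_real pi * cot_sum (2 * N + 1) (1 / \<tau>))"
    by (simp add: T2_def field_simps power2_eq_square)
  also have "2 * \<tau> ^ (2 * N + 1) * (1 / \<tau> ^ (2 * N) * T1) =
      of_real pi * cot_sum (2 * N + 1) \<tau> - zeta_even (N + 1) / \<tau>"
    by (simp add: T1_def field_simps)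
  finally have main: "of_real pi * (cot_sum (2 * N + 1) \<tau> + \<tau> ^ (2 * N) * cot_sum (2 * N + 1) (1 / \<tau>)) =
      \<tau> ^ (2 * N + 1) * zeta_even (N + 1) + zeta_even (N + 1) / \<tau> -
      2 * (\<Sum>i=1..N. \<tau> powi (2 * int N + 1 - 2 * int i) * (zeta_even i * zeta_even (N + 1 - i)))"
    by (simp add: algebra_simps)
  have p1: "\<tau> powi (2 * int N + 1) = \<tau> ^ (2 * N + 1)"
    using power_int_of_nat[of \<tau> "2 * N + 1"] by (simp add: add.commute)
  define R where "R = (\<Sum>i=1..N. \<tau> powi (2 * int N + 1 - 2 * int i) * (zeta_even i * zeta_even (N + 1 - i)))"
  \<comment> \<open>Since \<open>zeta_even 0 = - 1 / 2\<close>, the two end terms reproduce the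
    corrections contained in \<open>T1\<close> and \<open>T2\<close>.\<close>
  have "{0..N+1} = insert 0 (insert (N + 1) {1..N})" by auto
  hence sum_eq: "(\<Sum>j=0..N+1. \<tau> powi (2 * int N + 1 - 2 * int j) * (zeta_even j * zeta_even (N + 1 - j))) =
      \<tau> powi (2 * int N + 1) * (zeta_even 0 * zeta_even (N + 1)) +
      (\<tau> powi (- 1) * (zeta_even (N + 1) * zeta_even 0) + R)"
    by (simp add: R_def)
  have z0: "zeta_even 0 = - 1 / 2" by (simp add: zeta_even_def)
  show ?thesis
    unfolding main sum_eq p1 z0 R_def [symmetric] by (simp add: power_int_minus field_simps)
qed

section \<open>The Hecke relation and the Lambert series\<close>

lemma cot_minus_complex: "cot (- z) = - cot (z :: complex)"
  by (simp add: cot_def)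

lemma cot_pi_add_of_nat: "cot (of_real pi * (z + of_nat n)) = cot (of_real pi * z :: complex)"
proof (induction n)
  case (Suc n)
  have "of_real pi * (z + of_nat (Suc n)) = of_real pi * (z + of_nat n) + of_real pi"
    by (simp add: algebra_simps)
  thus ?case using Suc.IH by (simp add: cot_def sin_plus_pi cos_plus_pi)
qed simp

lemma exp_2pi_i_eq_1_iff: "exp (2 * of_real pi * \<i> * z) = 1 \<longleftrightarrow> z \<in> \<int>"
  unfolding exp_eq_1 by (auto simp: complex_eq_iff Ints_def)

lemma cot_pi_eq:
  assumes "z \<notin> \<int>"
  shows "cot (of_real pi * z) = \<i> * (1 + 2 / (exp (2 * of_real pi * \<i> * z) - 1))"
proof -
  define x where "x = of_real pi * z"
  have e: "exp (2 * of_real pi * \<i> * z) = exp (\<i> * x) * exp (\<i> * x)"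
    by (simp add: x_def algebra_simps flip: exp_add)
  have "exp (2 * of_real pi * \<i> * z) \<noteq> 1"
    using assms by (simp add: exp_2pi_i_eq_1_iff)
  hence ne: "exp (\<i> * x) * exp (\<i> * x) - 1 \<noteq> 0" by (simp add: e)
  have "exp (\<i> * x) * exp (- (\<i> * x)) = 1"
    by (simp flip: exp_add)
  moreover have "2 * \<i> * sin x = exp (\<i> * x) - exp (- (\<i> * x))"
                "2 * cos x = exp (\<i> * x) + exp (- (\<i> * x))"
    by (simp_all add: sin_exp_eq cos_exp_eq)
  ultimately have "2 * \<i> * sin x * exp (\<i> * x) = exp (\<i> * x) * exp (\<i> * x) - 1"
                  "2 * cos x * exp (\<i> * x) = exp (\<i> * x) * exp (\<i> * x) + 1"
    by (simp_all add: ring_distribs mult.commute)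
  moreover have "cot x = \<i> * (2 * cos x * exp (\<i> * x)) / (2 * \<i> * sin x * exp (\<i> * x))"
    by (simp add: cot_def)
  ultimately have "cot x = \<i> * (exp (\<i> * x) * exp (\<i> * x) + 1) / (exp (\<i> * x) * exp (\<i> * x) - 1)"
    by simp
  thus ?thesis
    using ne unfolding e x_def [symmetric] by (simp add: field_simps)
qed

text \<open>With \<open>\<omega>\<close> a primitive \<open>p\<close>-th root of unity,
  \<open>1 / (w * \<omega> ^ j - 1)\<close> is a finite geometric sum divided by
  \<open>w ^ p - 1\<close>, a denominator free of \<open>j\<close>. Summing over \<open>j\<close>
  kills every power except \<open>l = 0\<close>.\<close>

lemma cot_distribution:
  fixes z :: complex
  assumes "p > 0" "of_nat p * z \<notin> \<int>"
  shows "(\<Sum>j<p. cot (of_real pi * (z + of_nat j / of_nat p))) = of_nat p * cot (of_real pi * (of_nat p * z))"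
proof -
  define w where "w = exp (2 * of_real pi * \<i> * z)"
  define \<omega> where "\<omega> = exp (2 * of_real pi * \<i> * (1 / of_nat p))"
  have wp: "exp (2 * of_real pi * \<i> * (of_nat p * z)) = w ^ p"
    by (simp add: w_def mult_ac flip: exp_of_nat_mult)
  have "w ^ p \<noteq> 1"
    using assms by (simp add: exp_2pi_i_eq_1_iff flip: wp)
  have \<omega>: "\<omega> ^ l = exp (2 * of_real pi * \<i> * (of_nat l / of_nat p))" for l
    by (simp add: \<omega>_def mult_ac flip: exp_of_nat_mult)
  have \<omega>1: "\<omega> ^ p = 1"
    using assms by (simp only: \<omega> exp_2pi_i_eq_1_iff) simp
  have roots: "(\<Sum>j<p. (\<omega> ^ l) ^ j) = (if l = 0 then of_nat p else 0)" if "l < p" for l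
  proof (cases "l = 0")
    case False
    have "\<omega> ^ l \<noteq> 1"
    proof
      assume "\<omega> ^ l = 1"
      hence "of_nat l / of_nat p \<in> (\<int> :: complex set)"
        by (simp only: \<omega> exp_2pi_i_eq_1_iff)
      then obtain a :: int where "of_nat l / of_nat p = (of_int a :: complex)"
        by (auto elim: Ints_cases)
      hence "of_int (int l) = (of_int (a * int p) :: complex)"
        using assms by (simp add: field_simps)
      hence "int l = a * int p" by (simp only: of_int_eq_iff)
      hence "int p dvd int l" by simp
      thus False using False that by (auto dest: dvd_imp_le)
    qed
    moreover have "(\<omega> ^ l) ^ p = 1"
      using \<omega>1 by (metis power_commutes power_mult power_one mult.commute)
    ultimately show ?thesis using False by (simp add: sum_gp_strict)
  qed auto
  have summand: "cot (of_real pi * (z + of_nat j / of_nat p)) =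
      \<i> * (1 + 2 * ((\<Sum>l<p. w ^ l * (\<omega> ^ l) ^ j) / (w ^ p - 1)))" for j
  proof -
    have "z + of_nat j / of_nat p \<notin> \<int>"
    proof
      assume "z + of_nat j / of_nat p \<in> \<int>"
      hence "of_nat p * (z + of_nat j / of_nat p) - of_nat j \<in> \<int>" by simp
      thus False using assms by (simp add: algebra_simps)
    qed
    moreover have e: "exp (2 * of_real pi * \<i> * (z + of_nat j / of_nat p)) = w * \<omega> ^ j"
      by (simp add: w_def \<omega> ring_distribs exp_add)
    ultimately have ne: "w * \<omega> ^ j \<noteq> 1" and
      cot: "cot (of_real pi * (z + of_nat j / of_nat p)) = \<i> * (1 + 2 / (w * \<omega> ^ j - 1))"
      by (auto simp: exp_2pi_i_eq_1_iff cot_pi_eq simp flip: e)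
    have "(w * \<omega> ^ j) ^ p = w ^ p"
      using \<omega>1 by (metis mult.commute mult_1_right power_mult power_mult_distrib power_one)
    hence "(w * \<omega> ^ j - 1) * (\<Sum>l<p. (w * \<omega> ^ j) ^ l) = w ^ p - 1"
      by (metis power_diff_1_eq)
    moreover have "(\<Sum>l<p. (w * \<omega> ^ j) ^ l) = (\<Sum>l<p. w ^ l * (\<omega> ^ l) ^ j)"
      by (simp add: power_mult_distrib mult.commute flip: power_mult)
    ultimately have "(\<Sum>l<p. w ^ l * (\<omega> ^ l) ^ j) * (w * \<omega> ^ j - 1) = 1 * (w ^ p - 1)"
      by (simp only: mult.commute mult_1_left)
    hence "(\<Sum>l<p. w ^ l * (\<omega> ^ l) ^ j) / (w ^ p - 1) = 1 / (w * \<omega> ^ j - 1)"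
      using ne \<open>w ^ p \<noteq> 1\<close> by (subst frac_eq_eq) (simp_all only: right_minus_eq not_False_eq_True)
    thus ?thesis
      unfolding cot by simp
  qed
  have "(\<Sum>j<p. \<Sum>l<p. w ^ l * (\<omega> ^ l) ^ j) = (\<Sum>l<p. w ^ l * (\<Sum>j<p. (\<omega> ^ l) ^ j))"
    by (subst sum.swap) (simp add: sum_distrib_left)
  also have "\<dots> = (\<Sum>l<p. if l = 0 then of_nat p else 0)"
    by (intro sum.cong refl) (auto simp: roots)
  also have "\<dots> = of_nat p"
    using assms by simp
  finally have eq: "(\<Sum>j<p. cot (of_real pi * (z + of_nat j / of_nat p))) =
                  \<i> * (of_nat p + 2 * (of_nat p / (w ^ p - 1)))"
    unfolding summand by (simp add: sum.distrib flip: sum_distrib_left sum_divide_distrib)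
  show ?thesis
    unfolding eq cot_pi_eq[OF assms(2)] wp by (simp add: algebra_simps)
qed

section \<open>Parity, periodicity and Hecke relation of the cotangent sum\<close>

lemma cot_sum_minus: "cot_sum s (- \<tau>) = - cot_sum s \<tau>"
  by (simp add: cot_sum_def cot_minus_complex infsum_uminus)

lemma cot_sum_add_1: "cot_sum s (\<tau> + 1) = cot_sum s \<tau>"
proof -
  have "cot (of_real pi * (of_nat n * (\<tau> + 1))) = cot (of_real pi * (of_nat n * \<tau>))" for n
    using cot_pi_add_of_nat[of "of_nat n * \<tau>" n] by (simp add: algebra_simps)
  thus ?thesis by (simp add: cot_sum_def)
qed

text \<open>If \<open>p\<close> divides \<open>n\<close>, all summands agree by periodicity.
  Otherwise multiplication by \<open>n\<close> permutes the residues modulo \<open>p\<close>, and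
  the distribution relation applies.\<close>

lemma cot_sum_hecke_term:
  assumes "prime p" "Im \<tau> \<noteq> 0" "n > 0"
  shows "(\<Sum>j<p. cot (of_real pi * (of_nat n * ((\<tau> + of_nat j) / of_nat p)))) =
           of_nat p * (if p dvd n then cot (of_real pi * (of_nat (n div p) * \<tau>))
                       else cot (of_real pi * (of_nat n * \<tau>)))"
proof (cases "p dvd n")
  case True
  then obtain m where n: "n = p * m" by blast
  have "p > 0" using assms by (simp add: prime_gt_0_nat)
  have "cot (of_real pi * (of_nat n * ((\<tau> + of_nat j) / of_nat p))) = cot (of_real pi * (of_nat m * \<tau>))" for j
  proof -
    have "of_nat n * ((\<tau> + of_nat j) / of_nat p) = of_nat m * \<tau> + of_nat (m * j)"
      using \<open>p > 0\<close> by (simp add: n field_simps)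
    thus ?thesis by (simp only: cot_pi_add_of_nat)
  qed
  thus ?thesis using True \<open>p > 0\<close> by (simp add: n)
next
  case False
  hence cop: "coprime n p"
    using assms by (metis coprime_commute prime_imp_coprime)
  have "p > 0" using assms by (simp add: prime_gt_0_nat)
  define z where "z = of_nat n * \<tau> / of_nat p"
  have pz: "of_nat p * z = of_nat n * \<tau>" using \<open>p > 0\<close> by (simp add: z_def)
  have bij: "bij_betw (\<lambda>j. n * j mod p) {..<p} {..<p}"
  proof (rule bij_betw_imageI)
    show inj: "inj_on (\<lambda>j. n * j mod p) {..<p}"
    proof
      fix i j assume ij: "i \<in> {..<p}" "j \<in> {..<p}" "n * i mod p = n * j mod p"
      hence "[n * i = n * j] (mod p)" by (simp add: cong_def)
      hence "[i = j] (mod p)" using cop by (simp add: cong_mult_lcancel_nat)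
      thus "i = j" using ij by (simp add: cong_def)
    qed
    have "(\<lambda>j. n * j mod p) ` {..<p} \<subseteq> {..<p}" using \<open>p > 0\<close> by auto
    thus "(\<lambda>j. n * j mod p) ` {..<p} = {..<p}"
      by (intro card_subset_eq) (auto simp: card_image inj)
  qed
  have "cot (of_real pi * (of_nat n * ((\<tau> + of_nat j) / of_nat p))) =
          cot (of_real pi * (z + of_nat (n * j mod p) / of_nat p))" for j
  proof -
    have "of_nat (n * j) = (of_nat p * of_nat (n * j div p) + of_nat (n * j mod p) :: complex)"
      by (metis mult_div_mod_eq of_nat_add of_nat_mult)
    hence "of_nat n * ((\<tau> + of_nat j) / of_nat p) = z + of_nat (n * j mod p) / of_nat p + of_nat (n * j div p)"
      using \<open>p > 0\<close> by (simp add: z_def field_simps)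
    thus ?thesis by (simp only: cot_pi_add_of_nat)
  qed
  hence "(\<Sum>j<p. cot (of_real pi * (of_nat n * ((\<tau> + of_nat j) / of_nat p)))) =
           (\<Sum>j<p. cot (of_real pi * (z + of_nat j / of_nat p)))"
    by (simp add: sum.reindex_bij_betw[OF bij, of "\<lambda>j. cot (of_real pi * (z + of_nat j / of_nat p))"])
  also have "of_nat n * \<tau> \<notin> \<int>"
    using assms by (auto elim!: Ints_cases simp: complex_eq_iff)
  hence "(\<Sum>j<p. cot (of_real pi * (z + of_nat j / of_nat p))) = of_nat p * cot (of_real pi * (of_nat p * z))"
    using \<open>p > 0\<close> by (intro cot_distribution) (auto simp: pz)
  finally show ?thesis using False by (simp add: pz)
qed

theorem cot_sum_hecke:
  assumes p: "prime p" and \<tau>: "Im \<tau> \<noteq> 0" and N: "N \<ge> 1"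
  shows "(\<Sum>j<p. cot_sum (2 * N + 1) ((\<tau> + of_nat j) / of_nat p)) =
           (of_nat p + 1 / of_nat p ^ (2 * N)) * cot_sum (2 * N + 1) \<tau> -
             1 / of_nat p ^ (2 * N) * cot_sum (2 * N + 1) (of_nat p * \<tau>)"
proof -
  have "p > 0" using p by (simp add: prime_gt_0_nat)
  define s where "s = 2 * N + 1"
  define c :: "complex \<Rightarrow> nat \<Rightarrow> complex" where "c = (\<lambda>\<tau> n. cot (of_real pi * (of_nat n * \<tau>)) / of_nat n ^ s)"
  have c: "(c \<tau> has_sum cot_sum s \<tau>) {0<..}" if "Im \<tau> \<noteq> 0" for \<tau>
    using cot_sum_has_sum[OF that N] by (simp only: c_def s_def)
  \<comment> \<open>The deviation from \<open>p * c \<tau> n\<close>, supported on the multiples of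
    \<open>p\<close>. Putting \<open>n = p * m\<close> turns its sum into a combination of the sums
    at \<open>\<tau>\<close> and \<open>p * \<tau>\<close>.\<close>
  define h where "h = (\<lambda>n. if p dvd n then of_nat p * (c \<tau> (n div p) / of_nat p ^ s - c \<tau> n) else 0)"
  have "((\<lambda>m. of_nat p / of_nat p ^ s * (c \<tau> m - c (of_nat p * \<tau>) m)) has_sum
           of_nat p / of_nat p ^ s * (cot_sum s \<tau> - cot_sum s (of_nat p * \<tau>))) {0<..}"
  proof -
    have "((\<lambda>m. c \<tau> m + - 1 * c (of_nat p * \<tau>) m) has_sum
             (cot_sum s \<tau> + - 1 * cot_sum s (of_nat p * \<tau>))) {0<..}"
      using \<tau> \<open>p > 0\<close> by (intro has_sum_add has_sum_cmult_right c) auto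
    from has_sum_cmult_right[OF this, of "of_nat p / of_nat p ^ s"] show ?thesis
      by simp
  qed
  also have "(\<lambda>m. of_nat p / of_nat p ^ s * (c \<tau> m - c (of_nat p * \<tau>) m)) = h \<circ> (\<lambda>m. p * m)"
    using \<open>p > 0\<close> by (auto simp: h_def c_def power_mult_distrib fun_eq_iff field_simps)
  finally have "(h has_sum of_nat p / of_nat p ^ s * (cot_sum s \<tau> - cot_sum s (of_nat p * \<tau>))) ((\<lambda>m. p * m) ` {0<..})"
    using \<open>p > 0\<close> by (subst has_sum_reindex) (auto simp: o_def intro: inj_onI)
  also have "?this \<longleftrightarrow> (h has_sum of_nat p / of_nat p ^ s * (cot_sum s \<tau> - cot_sum s (of_nat p * \<tau>))) {0<..}"
    using \<open>p > 0\<close> by (intro has_sum_cong_neutral) (auto simp: h_def elim!: dvdE)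
  finally have "((\<lambda>n. of_nat p * c \<tau> n + h n) has_sum
      (of_nat p * cot_sum s \<tau> + of_nat p / of_nat p ^ s * (cot_sum s \<tau> - cot_sum s (of_nat p * \<tau>)))) {0<..}"
    using \<tau> by (intro has_sum_add has_sum_cmult_right c)
  note sum1 = this
  have sum2: "((\<lambda>n. \<Sum>j<p. c ((\<tau> + of_nat j) / of_nat p) n) has_sum
                    (\<Sum>j<p. cot_sum s ((\<tau> + of_nat j) / of_nat p))) {0<..}"
    using \<tau> \<open>p > 0\<close> by (intro has_sum_sum c) (simp add: Im_divide_of_nat)
  have terms: "(\<Sum>j<p. c ((\<tau> + of_nat j) / of_nat p) n) = of_nat p * c \<tau> n + h n" if "n \<in> {0<..}" for n
  proof -
    have "(\<Sum>j<p. c ((\<tau> + of_nat j) / of_nat p) n) = of_nat p * (if p dvd n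
            then cot (of_real pi * (of_nat (n div p) * \<tau>)) else cot (of_real pi * (of_nat n * \<tau>))) / of_nat n ^ s"
      using cot_sum_hecke_term[OF p \<tau>, of n] that unfolding c_def sum_divide_distrib [symmetric] by simp
    also have "\<dots> = of_nat p * c \<tau> n + h n"
      using \<open>p > 0\<close> by (auto simp: c_def h_def power_mult_distrib field_simps elim!: dvdE)
    finally show ?thesis .
  qed
  have "(\<Sum>j<p. cot_sum s ((\<tau> + of_nat j) / of_nat p)) =
      of_nat p * cot_sum s \<tau> + of_nat p / of_nat p ^ s * (cot_sum s \<tau> - cot_sum s (of_nat p * \<tau>))"
    by (rule has_sum_unique[OF has_sum_cong[THEN iffD1, OF terms sum2] sum1])
  also have "of_nat p / of_nat p ^ s = (1 / of_nat p ^ (2 * N) :: complex)"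
    using \<open>p > 0\<close> by (simp add: s_def)
  finally show ?thesis
    unfolding s_def by (simp only: ring_distribs) simp
qed

text \<open>Termwise, \<open>\<i> / 2 * cot (pi * n * \<tau>) - 1 / 2\<close> equals
  \<open>q ^ n / (1 - q ^ n)\<close>; division by \<open>n ^ (2 * N + 1)\<close> and summation
  produce the zeta value and the Lambert series.\<close>

lemma cot_sum_eq_zeta_lambert:
  assumes \<tau>: "Im \<tau> > 0" and N: "N \<ge> 1"
  shows "cot_sum (2 * N + 1) \<tau> =
           - \<i> * (zeta (of_nat (2 * N + 1)) + 2 * lambert (exp (2 * of_real pi * \<i> * \<tau>)) (- of_nat (2 * N + 1)))"
proof -
  define q where "q = exp (2 * of_real pi * \<i> * \<tau>)"
  define s where "s = 2 * N + 1"
  have z: "((\<lambda>n. 1 / of_nat n ^ s) has_sum (\<Sum>\<^sub>\<infinity>n\<in>{0<..}. 1 / of_nat n ^ s :: complex)) {0<..}"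
    using N by (intro has_sum_infsum abs_summable_summable[OF inverse_power_norm_summable])
               (simp add: s_def)
  have "(\<lambda>n. 1 / of_nat (Suc n) ^ s :: complex) sums (\<Sum>\<^sub>\<infinity>n\<in>{0<..}. 1 / of_nat n ^ s)"
    using z unfolding has_sum_pos_nat_iff by (rule has_sum_imp_sums)
  hence zeta: "zeta (of_nat s) = (\<Sum>\<^sub>\<infinity>n\<in>{0<..}. 1 / of_nat n ^ s)"
    using N by (simp add: zeta_def zeta_series_def s_def powr_nat' sums_iff del: of_nat_Suc of_nat_add)
  have "((\<lambda>n. \<i> / 2 * (cot (of_real pi * (of_nat n * \<tau>)) / of_nat n ^ s) + (- 1 / 2) * (1 / of_nat n ^ s)) has_sum
           (\<i> / 2 * cot_sum s \<tau> + (- 1 / 2) * zeta (of_nat s))) {0<..}"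
    using \<tau> N unfolding s_def
    by (intro has_sum_add has_sum_cmult_right cot_sum_has_sum z[folded zeta, unfolded s_def]) auto
  hence "(\<lambda>n. \<i> / 2 * (cot (of_real pi * (of_nat (Suc n) * \<tau>)) / of_nat (Suc n) ^ s) +
           (- 1 / 2) * (1 / of_nat (Suc n) ^ s)) sums (\<i> / 2 * cot_sum s \<tau> + (- 1 / 2) * zeta (of_nat s))"
    unfolding has_sum_pos_nat_iff by (rule has_sum_imp_sums)
  also have "(\<lambda>n. \<i> / 2 * (cot (of_real pi * (of_nat (Suc n) * \<tau>)) / of_nat (Suc n) ^ s) +
           (- 1 / 2) * (1 / of_nat (Suc n) ^ s)) =
           (\<lambda>n. of_nat (Suc n) powr (- of_nat s) * q ^ Suc n / (1 - q ^ Suc n))"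
  proof
    fix n
    have notint: "of_nat (Suc n) * \<tau> \<notin> \<int>"
      using \<tau> by (auto elim!: Ints_cases simp: complex_eq_iff simp del: of_nat_Suc)
    have e: "exp (2 * of_real pi * \<i> * (of_nat (Suc n) * \<tau>)) = q ^ Suc n"
      by (simp add: q_def mult_ac del: of_nat_Suc power_Suc flip: exp_of_nat_mult)
    have ne: "q ^ Suc n \<noteq> 1"
      using notint by (simp only: exp_2pi_i_eq_1_iff simp_thms flip: e)
    have cot: "cot (of_real pi * (of_nat (Suc n) * \<tau>)) = \<i> * (1 + 2 / (q ^ Suc n - 1))"
      using cot_pi_eq[OF notint] by (simp only: e)
    have pw: "of_nat (Suc n) powr (- of_nat s) = (1 / of_nat (Suc n) ^ s :: complex)"
      by (simp add: powr_minus powr_nat' divide_inverse del: of_nat_Suc)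
    have "\<i> / 2 * (\<i> * (1 + 2 / (Q - 1)) / W) + (- 1 / 2) * (1 / W) = 1 / W * Q / (1 - Q)"
      if "Q \<noteq> 1" "W \<noteq> 0" for Q W :: complex
    proof -
      have "Q - 1 \<noteq> 0" "1 - Q \<noteq> 0" using that by auto
      thus ?thesis using that by (simp add: divide_simps) (simp add: algebra_simps)
    qed
    thus "\<i> / 2 * (cot (of_real pi * (of_nat (Suc n) * \<tau>)) / of_nat (Suc n) ^ s) +
           (- 1 / 2) * (1 / of_nat (Suc n) ^ s) = of_nat (Suc n) powr (- of_nat s) * q ^ Suc n / (1 - q ^ Suc n)"
      unfolding cot pw using ne by (simp del: of_nat_Suc power_Suc)
  qed
  finally have "lambert q (- of_nat s) = \<i> / 2 * cot_sum s \<tau> + (- 1 / 2) * zeta (of_nat s)"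
    unfolding lambert_def by (simp only: sums_iff)
  hence "- \<i> * (zeta (of_nat s) + 2 * lambert q (- of_nat s)) = cot_sum s \<tau>"
    by (simp add: algebra_simps)
  thus ?thesis by (simp add: s_def q_def)
qed

section \<open>The coefficients\<close>

text \<open>Ramanujan's polynomial divided by \<open>\<tau>\<close>: the exponents are odd and
  descend to \<open>- 1\<close> at \<open>j = N + 1\<close>, hence \<open>powi\<close>.\<close>

definition ramanujan_poly :: "nat \<Rightarrow> complex \<Rightarrow> complex" where
  "ramanujan_poly N \<tau> = (\<Sum>j=0..N+1. \<tau> powi (2 * int N + 1 - 2 * int j) *
     of_real (bernoulli (2 * j) / fact (2 * j) * (bernoulli (2 * (N + 1 - j)) / fact (2 * (N + 1 - j)))))"

lemma cot_sum_ramanujan: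
  assumes \<tau>: "Im \<tau> \<noteq> 0" and N: "N \<ge> 1"
  shows "cot_sum (2 * N + 1) \<tau> + \<tau> ^ (2 * N) * cot_sum (2 * N + 1) (1 / \<tau>) =
           (-1) ^ N * of_real ((2 * pi) ^ (2 * N + 1)) * ramanujan_poly N \<tau>"
proof -
  \<comment> \<open>The two powers of \<open>2 * pi * \<i>\<close> have total exponent
    \<open>2 * N + 2\<close> whatever \<open>j\<close> is, so they leave the sum as a
    constant.\<close>
  have zz: "zeta_even j * zeta_even (N + 1 - j) = (2 * of_real pi * \<i>) ^ (2 * N + 2) / 4 *
      of_real (bernoulli (2 * j) / fact (2 * j) * (bernoulli (2 * (N + 1 - j)) / fact (2 * (N + 1 - j))))"
    if "j \<in> {0..N+1}" for j
  proof -
    have "2 * N + 2 = 2 * j + 2 * (N + 1 - j)" using that by auto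
    hence pw: "(2 * of_real pi * \<i>) ^ (2 * N + 2) = (2 * of_real pi * \<i>) ^ (2 * j) * (2 * of_real pi * \<i>) ^ (2 * (N + 1 - j))"
      by (simp only: power_add)
    show ?thesis unfolding zeta_even_bernoulli pw by (simp only: of_real_mult) simp
  qed
  have "of_real pi * (cot_sum (2 * N + 1) \<tau> + \<tau> ^ (2 * N) * cot_sum (2 * N + 1) (1 / \<tau>)) =
      - 2 * ((2 * of_real pi * \<i>) ^ (2 * N + 2) / 4 * ramanujan_poly N \<tau>)"
    unfolding cot_sum_transformation[OF assms] ramanujan_poly_def sum_distrib_left[of "_ / 4"]
    by (intro arg_cong[where f = "\<lambda>x. - 2 * x"] sum.cong refl) (simp only: zz mult_ac)
  also have "(2 * of_real pi * \<i>) ^ (2 * N + 2) = - ((-1) ^ N * of_real ((2 * pi) ^ (2 * N + 1)) * (2 * of_real pi))"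
  proof -
    have "\<i> ^ (2 * N + 2) = - ((-1) ^ N)" by (simp add: power_mult)
    moreover have "(2 * of_real pi) ^ (2 * N + 2) = of_real ((2 * pi) ^ (2 * N + 1)) * (2 * of_real pi :: complex)"
      by simp
    ultimately show ?thesis
      unfolding power_mult_distrib[of "2 * of_real pi" \<i>] by (simp only: mult_ac mult_minus_left mult_minus_right)
  qed
  finally have "of_real pi * (cot_sum (2 * N + 1) \<tau> + \<tau> ^ (2 * N) * cot_sum (2 * N + 1) (1 / \<tau>)) =
      of_real pi * ((-1) ^ N * of_real ((2 * pi) ^ (2 * N + 1)) * ramanujan_poly N \<tau>)"
    by simp
  thus ?thesis by simp
qed

lemma neg4_power: "(-1) ^ k * 2 ^ (2 * k) = (- 4 :: real) ^ k"
  by (simp add: power_mult flip: power_mult_distrib)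

lemma a_coeff_denom_pos: "(2::real) ^ (4 * k + 1) - (-4) ^ k + 1 > 0"
proof -
  have "(-4 :: real) ^ k \<le> \<bar>(-4) ^ k\<bar>" by (rule abs_ge_self)
  also have "\<dots> = 4 ^ k" by (simp add: power_abs)
  also have "\<dots> \<le> 16 ^ k" by (intro power_mono) auto
  finally have "(-4 :: real) ^ k \<le> 16 ^ k" .
  moreover have "(0 :: real) < 16 ^ k" by simp
  moreover have "(2 :: real) ^ (4 * k + 1) = 2 * 16 ^ k" by (simp add: power_mult)
  ultimately show ?thesis by linarith
qed

text \<open>The shape in which the coefficient arises from the elimination. The definition of
  \<open>a_coeff\<close> gives \<open>a_coeff k * (2 * v - u + 1) = v * (w + 1)\<close>; lowering
  the bracket by \<open>2\<close> costs \<open>2 * a_coeff k\<close>.\<close>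

lemma b_coeff_eq: "b_coeff k = a_coeff k / 2 ^ (4 * k) - 1 - (-4) ^ k"
proof -
  define u v w where "u = (-4 :: real) ^ k" and "v = (2::real) ^ (4 * k)" and "w = (3::real) ^ (4 * k + 1)"
  have "v > 0" and d: "2 * v - u + 1 \<noteq> 0"
    using a_coeff_denom_pos[of k] by (auto simp: u_def v_def)
  have a: "a_coeff k = v * (w + 1) / (2 * v - u + 1)"
    by (simp add: a_coeff_def neg4_power u_def v_def w_def)
  have b: "b_coeff k = (w - 1) / 2 - u - a_coeff k * ((2 * v - u - 1) / (2 * v))"
    by (simp add: b_coeff_def neg4_power u_def v_def w_def)
  have "a_coeff k * (2 * v - u + 1) = v * (w + 1)" using d by (simp add: a)
  hence "a_coeff k * (2 * v - u - 1) = v * (w + 1) - 2 * a_coeff k"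
    by (simp add: algebra_simps)
  hence "a_coeff k * ((2 * v - u - 1) / (2 * v)) = (v * (w + 1) - 2 * a_coeff k) / (2 * v)"
    by simp
  also have "\<dots> = (w + 1) / 2 - a_coeff k / v"
    using \<open>v > 0\<close> by (simp add: diff_divide_distrib)
  finally have "b_coeff k = a_coeff k / v - 1 - u"
    unfolding b by (simp add: field_simps)
  thus ?thesis by (simp add: u_def v_def)
qed

text \<open>With \<open>u = (-4) ^ k\<close>, clearing the denominator leaves
  \<open>3 * 81 ^ k - 2 * u ^ 3 - u ^ 2\<close>. For even \<open>k\<close> the powers
  \<open>64 ^ k\<close> and \<open>16 ^ k\<close> are dominated by \<open>81 ^ k\<close>; for odd
  \<open>k\<close> the factor \<open>1 + u\<close> is negative.\<close>

lemma b_coeff_nonzero: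
  assumes "k \<ge> 1"
  shows "b_coeff k \<noteq> 0"
proof -
  define u where "u = (-4 :: real) ^ k"
  have sq: "2 ^ (4 * k) = u ^ 2" by (simp add: u_def power_mult power2_eq_square flip: power_mult_distrib)
  have cube: "3 ^ (4 * k + 1) = (3 * 81 ^ k :: real)" by (simp add: power_mult)
  have "(3 * 81 ^ k + 1) - (1 + u) * (2 * u ^ 2 - u + 1) > 0"
  proof (cases "even k")
    case True
    hence "u = 4 ^ k" by (simp add: u_def)
    hence "u ^ 3 = 64 ^ k" "u ^ 2 = 16 ^ k"
      by (simp_all add: power2_eq_square power3_eq_cube flip: power_mult_distrib)
    moreover have "(64::real) ^ k \<le> 81 ^ k" "(16::real) ^ k < 81 ^ k"
      using assms by (auto intro!: power_mono power_strict_mono)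
    moreover have "(1 + u) * (2 * u ^ 2 - u + 1) = 2 * u ^ 3 + u ^ 2 + 1"
      by (simp add: algebra_simps power2_eq_square power3_eq_cube)
    ultimately show ?thesis by linarith
  next
    case False
    hence u: "u = - (4 ^ k)" by (simp add: u_def)
    have "(4::real) ^ 1 \<le> 4 ^ k" using assms by (intro power_increasing) auto
    hence "(1 + u) * (2 * u ^ 2 - u + 1) \<le> 0"
      unfolding u by (intro mult_nonpos_nonneg) auto
    moreover have "(0 :: real) < 81 ^ k" by simp
    ultimately show ?thesis by linarith
  qed
  moreover have "b_coeff k * (2 * u ^ 2 - u + 1) = (3 * 81 ^ k + 1) - (1 + u) * (2 * u ^ 2 - u + 1)"
  proof -
    have d: "2 * u ^ 2 - u + 1 \<noteq> 0"
      using a_coeff_denom_pos[of k] unfolding power_add sq u_def [symmetric] by simp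
    have "a_coeff k = u ^ 2 * (3 * 81 ^ k + 1) / (2 * u ^ 2 - u + 1)"
      unfolding a_coeff_def neg4_power cube unfolding power_add sq u_def [symmetric]
      by (simp add: mult.commute)
    moreover have "u \<noteq> 0" by (simp add: u_def)
    ultimately have "a_coeff k / 2 ^ (4 * k) = (3 * 81 ^ k + 1) / (2 * u ^ 2 - u + 1)"
      unfolding sq by simp
    hence b: "b_coeff k = (3 * 81 ^ k + 1) / (2 * u ^ 2 - u + 1) - (1 + u)"
      unfolding b_coeff_eq u_def [symmetric] by simp
    show ?thesis
      unfolding b left_diff_distrib[of _ "1 + u"] nonzero_eq_divide_eq[OF d, symmetric]
      using d by simp
  qed
  ultimately show ?thesis by auto
qed

section \<open>Elimination\<close>

text \<open>The relations for \<open>p = 3\<close> and \<open>p = 2\<close> give \<open>cot_sum (4 * k + 1) \<i>\<close> the coefficients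
  \<open>3 ^ (4 * k + 1) + 1\<close> and \<open>2 ^ (4 * k + 1) - (-4) ^ k + 1\<close>, whose ratio is \<open>a_coeff k / 2 ^ (4 * k)\<close>.\<close>
lemma zeta_lambert_ramanujan:
  fixes k :: nat
  assumes k: "k \<ge> 1"
  shows "of_real (b_coeff k) * zeta (of_nat (4 * k + 1)) =
     of_real ((2 * pi) ^ (4 * k + 1)) / 2 * (\<i> * (3 ^ (4 * k) *
        (ramanujan_poly (2 * k) (\<i> / 3) + ramanujan_poly (2 * k) ((\<i> + 1) / 3) + ramanujan_poly (2 * k) ((\<i> - 1) / 3)) -
        of_real (a_coeff k) * (ramanujan_poly (2 * k) (\<i> / 2) + ramanujan_poly (2 * k) ((\<i> - 1) / 2))))
     + 2 * (-4) ^ k * lambert (- of_real (exp (- 3 * pi))) (- of_nat (4 * k + 1))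
     - 2 * of_real (a_coeff k / 2 ^ (4 * k)) * lambert (of_real (exp (- 4 * pi))) (- of_nat (4 * k + 1))
     + 2 * lambert (of_real (exp (- 6 * pi))) (- of_nat (4 * k + 1))"
proof -
  define C where "C = cot_sum (4 * k + 1)"
  define R where "R = ramanujan_poly (2 * k)"
  define M :: complex where "M = of_real ((2 * pi) ^ (4 * k + 1))"
  define L where "L = (\<lambda>q. lambert q (- of_nat (4 * k + 1)))"
  define Z where "Z = zeta (of_nat (4 * k + 1))"
  define \<mu> where "\<mu> = 3 * (\<i> - 1) / 2"
  define D :: complex where "D = (-4) ^ k"
  define T :: complex where "T = 3 ^ (4 * k)"
  define W :: complex where "W = 2 ^ (4 * k)"
  define a :: complex where "a = of_real (a_coeff k)"
  have TW: "T \<noteq> 0" "W \<noteq> 0" by (auto simp: T_def W_def)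
  have per: "C (\<tau> + 1) = C \<tau>" and neg: "C (- \<tau>) = - C \<tau>" for \<tau>
    by (simp_all add: C_def cot_sum_add_1 cot_sum_minus)
  have kk: "2 * (2 * k) = 4 * k" by simp
  have S: "C \<tau> + \<tau> ^ (4 * k) * C (1 / \<tau>) = M * R \<tau>" if "Im \<tau> \<noteq> 0" for \<tau>
    using cot_sum_ramanujan[OF that, of "2 * k"] k unfolding C_def R_def M_def kk by simp
  have H: "(\<Sum>j<p. C ((\<i> + of_nat j) / of_nat p)) =
      (of_nat p + 1 / of_nat p ^ (4 * k)) * C \<i> - 1 / of_nat p ^ (4 * k) * C (of_nat p * \<i>)" if "prime p" for p
    using cot_sum_hecke[OF that, of \<i> "2 * k"] k unfolding C_def kk by simp
  have CL: "C \<tau> = - \<i> * (Z + 2 * L (exp (2 * of_real pi * \<i> * \<tau>)))" if "Im \<tau> > 0" for \<tau>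
    using cot_sum_eq_zeta_lambert[OF that, of "2 * k"] k unfolding C_def Z_def L_def kk by simp

  have pow1: "(\<i> / 3) ^ (4 * k) = 1 / T" "(\<i> / 2) ^ (4 * k) = 1 / W"
    by (simp_all add: T_def W_def power_divide power_mult)
  have i4: "(\<i> + 1) ^ 4 = -4" "(\<i> - 1) ^ 4 = -4"
    by (simp_all add: eval_nat_numeral algebra_simps)
  have pow2: "((\<i> + 1) / 3) ^ (4 * k) = D / T" "((\<i> - 1) / 3) ^ (4 * k) = D / T" "((\<i> - 1) / 2) ^ (4 * k) = D / W"
    unfolding power_divide power_mult[of "\<i> + 1"] power_mult[of "\<i> - 1"] i4 T_def W_def D_def by (rule refl)+
  \<comment> \<open>Each reciprocal is minus a point of the upper half plane. The last two but one
    differ by an integer: \<open>\<mu> + 3\<close> is written with repeated \<open>+ 1\<close> so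
    that \<open>per\<close> removes it.\<close>
  have inv: "1 / (\<i> / 3) = - (3 * \<i>)" "1 / (\<i> / 2) = - (2 * \<i>)"
    "1 / ((\<i> + 1) / 3) = - \<mu>" "1 / ((\<i> - 1) / 3) = - (\<mu> + 1 + 1 + 1)" "1 / ((\<i> - 1) / 2) = - (\<i> + 1)"
    by (simp_all add: \<mu>_def complex_eq_iff Re_divide Im_divide power2_eq_square)
  have S3: "C (\<i> / 3) = M * R (\<i> / 3) + 1 / T * C (3 * \<i>)"
           "C ((\<i> + 1) / 3) = M * R ((\<i> + 1) / 3) + D / T * C \<mu>"
           "C ((\<i> - 1) / 3) = M * R ((\<i> - 1) / 3) + D / T * C \<mu>"
    using S[of "\<i> / 3"] S[of "(\<i> + 1) / 3"] S[of "(\<i> - 1) / 3"]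
    unfolding inv pow1 pow2 neg per by (simp_all add: algebra_simps)
  have S2: "C (\<i> / 2) = M * R (\<i> / 2) + 1 / W * C (2 * \<i>)"
           "C ((\<i> - 1) / 2) = M * R ((\<i> - 1) / 2) + D / W * C \<i>"
    using S[of "\<i> / 2"] S[of "(\<i> - 1) / 2"]
    unfolding inv pow1 pow2 neg per by (simp_all add: algebra_simps)
  \<comment> \<open>The largest shift in each Hecke sum is moved by one period to the point
    symmetric about the imaginary axis or already inverted.\<close>
  have "C ((\<i> + 2) / 3) = C ((\<i> - 1) / 3)" "C ((\<i> + 1) / 2) = C ((\<i> - 1) / 2)"
    using per[of "(\<i> - 1) / 3"] per[of "(\<i> - 1) / 2"] by (simp_all add: field_simps)
  hence H3: "C (\<i> / 3) + C ((\<i> + 1) / 3) + C ((\<i> - 1) / 3) = (3 + 1 / T) * C \<i> - 1 / T * C (3 * \<i>)"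
    and H2: "C (\<i> / 2) + C ((\<i> - 1) / 2) = (2 + 1 / W) * C \<i> - 1 / W * C (2 * \<i>)"
    using H[of 3] H[of 2] by (simp_all add: T_def W_def lessThan_nat_numeral add_ac)
  define R3 where "R3 = R (\<i> / 3) + R ((\<i> + 1) / 3) + R ((\<i> - 1) / 3)"
  define R2 where "R2 = R (\<i> / 2) + R ((\<i> - 1) / 2)"
  \<comment> \<open>\<open>C (3 * \<i>)\<close> occurs twice, once from the Hecke relation and once
    from inverting \<open>\<i> / 3\<close>; likewise \<open>C (2 * \<i>)\<close> in
    \<open>E2\<close>. There \<open>D * C \<i>\<close>, from inverting
    \<open>(\<i> - 1) / 2\<close>, moves to the right-hand side.\<close>
  have E3: "T * M * R3 + 2 * C (3 * \<i>) + 2 * D * C \<mu> = (3 * T + 1) * C \<i>"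
    using arg_cong[OF H3, of "\<lambda>x. T * x"] TW unfolding S3 R3_def by (simp add: algebra_simps)
  have E2: "W * M * R2 + 2 * C (2 * \<i>) = (2 * W - D + 1) * C \<i>"
    using arg_cong[OF H2, of "\<lambda>x. W * x"] TW unfolding S2 R2_def by (simp add: algebra_simps)
  have a: "a * (2 * W - D + 1) = W * (3 * T + 1)"
  proof -
    have "a_coeff k * (2 ^ (4 * k + 1) - (-4) ^ k + 1) = 2 ^ (4 * k) * (3 ^ (4 * k + 1) + 1)"
      using a_coeff_denom_pos[of k] by (simp add: a_coeff_def neg4_power)
    hence "complex_of_real (a_coeff k * (2 ^ (4 * k + 1) - (-4) ^ k + 1)) =
             complex_of_real (2 ^ (4 * k) * (3 ^ (4 * k + 1) + 1))"
      by (simp only:)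
    thus ?thesis by (simp add: a_def W_def D_def T_def)
  qed
  have "W * (T * M * R3 + 2 * C (3 * \<i>) + 2 * D * C \<mu>) = a * (W * M * R2 + 2 * C (2 * \<i>))"
    unfolding E3 E2 using a by (simp only: mult.assoc [symmetric])
  hence elim: "T * M * R3 + 2 * C (3 * \<i>) + 2 * D * C \<mu> = a * M * R2 + 2 * (a / W) * C (2 * \<i>)"
    using TW by (simp add: field_simps)
  have b: "of_real (b_coeff k) = a / W - 1 - D"
    by (simp add: b_coeff_eq a_def W_def D_def)
  have q: "exp (2 * of_real pi * \<i> * (3 * \<i>)) = of_real (exp (- 6 * pi))"
          "exp (2 * of_real pi * \<i> * (2 * \<i>)) = of_real (exp (- 4 * pi))"
          "exp (2 * of_real pi * \<i> * \<mu>) = - of_real (exp (- 3 * pi))"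
  proof -
    \<comment> \<open>The imaginary part is \<open>- 3 * pi\<close>: one full period drops out and
      the remaining half period gives the minus sign.\<close>
    have eq: "2 * of_real pi * \<i> * \<mu> = of_real (- 3 * pi) + - (of_real pi * \<i>) - 2 * of_real pi * \<i>"
      by (simp add: \<mu>_def field_simps)
    show "exp (2 * of_real pi * \<i> * \<mu>) = - of_real (exp (- 3 * pi))"
      unfolding eq exp_diff exp_add exp_minus exp_pi_i exp_two_pi_i exp_of_real by simp
  qed (simp_all add: mult_ac flip: exp_of_real)
  have "Im \<mu> > 0" by (simp add: \<mu>_def)
  have CL': "C (3 * \<i>) = - \<i> * (Z + 2 * L (of_real (exp (- 6 * pi))))"
            "C (2 * \<i>) = - \<i> * (Z + 2 * L (of_real (exp (- 4 * pi))))"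
            "C \<mu> = - \<i> * (Z + 2 * L (- of_real (exp (- 3 * pi))))"
    using CL[of "3 * \<i>"] CL[of "2 * \<i>"] CL[OF \<open>Im \<mu> > 0\<close>] by (simp_all only: q) auto
  have alg: "(A - 1 - D) * Z = M / 2 * (\<i> * (T * R3 - a * R2)) + 2 * D * l3 - 2 * A * l2 + 2 * l1"
    if "T * M * R3 + 2 * (- \<i> * (Z + 2 * l1)) + 2 * D * (- \<i> * (Z + 2 * l3)) =
          a * M * R2 + 2 * A * (- \<i> * (Z + 2 * l2))" for A l1 l2 l3
  proof -
    have "\<i> * (T * M * R3 + 2 * (- \<i> * (Z + 2 * l1)) + 2 * D * (- \<i> * (Z + 2 * l3))) =
          \<i> * (a * M * R2 + 2 * A * (- \<i> * (Z + 2 * l2)))"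
      using that by simp
    hence "2 * ((A - 1 - D) * Z) =
        2 * (M / 2 * (\<i> * (T * R3 - a * R2)) + 2 * D * l3 - 2 * A * l2 + 2 * l1)"
      by (simp add: algebra_simps)
    thus ?thesis by (simp only: mult_cancel_left) simp
  qed
  have "(a / W - 1 - D) * Z = M / 2 * (\<i> * (T * R3 - a * R2)) + 2 * D * L (- of_real (exp (- 3 * pi))) -
          2 * (a / W) * L (of_real (exp (- 4 * pi))) + 2 * L (of_real (exp (- 6 * pi)))"
    by (rule alg) (use elim in \<open>simp only: CL'\<close>)
  thus ?thesis
    unfolding b [symmetric] by (simp add: Z_def M_def T_def R3_def R2_def a_def W_def D_def L_def R_def)
qed

text \<open>The terms of the Ramanujan polynomials at \<open>j\<close> and \<open>2 k + 1 - j\<close> combine into \<open>c_coeff j k\<close>,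
  since this exchanges the two exponents \<open>r\<close> and \<open>t\<close> in its definition.\<close>
lemma ramanujan_poly_c_coeff:
  "\<i> * (3 ^ (4 * k) *
        (ramanujan_poly (2 * k) (\<i> / 3) + ramanujan_poly (2 * k) ((\<i> + 1) / 3) + ramanujan_poly (2 * k) ((\<i> - 1) / 3)) -
        of_real (a_coeff k) * (ramanujan_poly (2 * k) (\<i> / 2) + ramanujan_poly (2 * k) ((\<i> - 1) / 2))) =
   (\<Sum>j=0..k. (-1) ^ (j+1) * c_coeff j k
            * of_real (bernoulli (2*j)) * of_real (bernoulli (4*k+2-2*j))
            / (fact (2*j) * fact (4*k+2-2*j)))"
proof -
  define \<beta> :: "nat \<Rightarrow> complex" where "\<beta> = (\<lambda>j. of_real (bernoulli (2 * j) / fact (2 * j)))"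
  \<comment> \<open>One half of \<open>c_coeff\<close>, which is antisymmetric under exchange of its
    two exponents.\<close>
  define U where "U = (\<lambda>r t. 3 powi t * (1 + (1 + \<i>) powi r + (1 - \<i>) powi r) -
                         of_real (a_coeff k) * ((1 + (1 + \<i>) powi r) / 2 powi r))"
  define r where "r = (\<lambda>j. 4 * int k + 1 - 2 * int j)"
  define t where "t = (\<lambda>j. 2 * int j - 1)"
  define f where "f = (\<lambda>j. (-1) ^ (j + 1) * U (r j) (t j) * (\<beta> j * \<beta> (2 * k + 1 - j)))"
  have c: "c_coeff j k = U (r j) (t j) - U (t j) (r j)" for j
  proof -
    have "{-1..1::int} = {-1, 0, 1}" by auto
    hence *: "(\<Sum>n\<in>{-1..1::int}. (1 + \<i> * of_int n) powi e) = 1 + (1 + \<i>) powi e + (1 - \<i>) powi e" for e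
      by (simp add: add_ac)
    show ?thesis
      unfolding c_coeff_def Let_def * U_def r_def t_def by (simp only: right_diff_distrib) simp
  qed
  have R: "ramanujan_poly (2 * k) \<tau> = (\<Sum>j=0..2*k+1. \<tau> powi r j * (\<beta> j * \<beta> (2 * k + 1 - j)))" for \<tau>
    by (simp add: ramanujan_poly_def r_def \<beta>_def)
  \<comment> \<open>Uses \<open>\<i> powi r j = \<i> * (-1) ^ j\<close>, the rotations
    \<open>\<i> \<plusminus> 1 = \<i> * (1 \<mp> \<i>)\<close>, and
    \<open>r j + t j = 4 * k\<close>, by which \<open>3 ^ (4 * k)\<close> over
    \<open>3 powi r j\<close> becomes \<open>3 powi t j\<close>.\<close>
  have summand: "\<i> * (3 ^ (4 * k) * ((\<i> / 3) powi r j + ((\<i> + 1) / 3) powi r j + ((\<i> - 1) / 3) powi r j) -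
        of_real (a_coeff k) * ((\<i> / 2) powi r j + ((\<i> - 1) / 2) powi r j)) = (-1) ^ (j + 1) * U (r j) (t j)" for j
  proof -
    define x y where "x = (1 + \<i>) powi r j" and "y = (1 - \<i>) powi r j"
    define p3 p2 :: complex where "p3 = 3 powi r j" and "p2 = 2 powi r j"
    have "\<i> powi r j * \<i> powi int (2 * j) = \<i> powi (r j + int (2 * j))"
      by (rule power_int_add [symmetric]) simp
    also have "r j + int (2 * j) = int (4 * k + 1)"
      by (simp add: r_def)
    finally have "\<i> powi r j * (-1) ^ j = \<i>"
      unfolding power_int_of_nat by (simp add: power_mult)
    hence "\<i> powi r j * ((-1) ^ j * (-1) ^ j) = \<i> * (-1) ^ j"
      by (simp only: mult.assoc [symmetric])
    hence i: "\<i> powi r j = \<i> * (-1) ^ j"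
      by (simp flip: power_mult_distrib)
    have e: "\<i> + 1 = \<i> * (1 - \<i>)" "\<i> - 1 = \<i> * (1 + \<i>)" by (simp_all add: algebra_simps)
    have "(3 :: complex) powi r j * 3 powi t j = 3 powi (r j + t j)"
      by (rule power_int_add [symmetric]) simp
    also have "r j + t j = int (4 * k)"
      by (simp add: r_def t_def)
    finally have "(3 :: complex) ^ (4 * k) = p3 * 3 powi t j"
      unfolding power_int_of_nat p3_def by simp
    moreover have "p3 \<noteq> 0" by (simp add: p3_def)
    ultimately show ?thesis
      unfolding e power_int_divide_distrib power_int_mult_distrib i U_def
        x_def [symmetric] y_def [symmetric] p3_def [symmetric] p2_def [symmetric]
      by (simp add: algebra_simps add_divide_distrib)
  qed
  have "\<i> * (3 ^ (4 * k) *
        (ramanujan_poly (2 * k) (\<i> / 3) + ramanujan_poly (2 * k) ((\<i> + 1) / 3) + ramanujan_poly (2 * k) ((\<i> - 1) / 3)) -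
        of_real (a_coeff k) * (ramanujan_poly (2 * k) (\<i> / 2) + ramanujan_poly (2 * k) ((\<i> - 1) / 2))) =
     (\<Sum>j=0..2*k+1. f j)"
    unfolding R f_def summand [symmetric]
    by (simp only: ring_distribs sum.distrib sum_distrib_left sum_subtractf mult.assoc)
  also have "{0..2*k+1} = {0..k} \<union> {k+1..2*k+1}" by auto
  also have "sum f ({0..k} \<union> {k+1..2*k+1}) = sum f {0..k} + sum f {k+1..2*k+1}"
    by (rule sum.union_disjoint) auto
  also have "sum f {k+1..2*k+1} = (\<Sum>j=0..k. f (2 * k + 1 - j))"
    by (rule sum.reindex_bij_witness[of _ "\<lambda>j. 2 * k + 1 - j" "\<lambda>j. 2 * k + 1 - j"]) auto
  also have "sum f {0..k} + \<dots> = (\<Sum>j=0..k. (-1) ^ (j+1) * c_coeff j k * (\<beta> j * \<beta> (2 * k + 1 - j)))"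
    unfolding sum.distrib [symmetric]
  proof (intro sum.cong refl)
    fix j assume "j \<in> {0..k}"
    hence j: "j \<le> k" by simp
    have swap: "r (2 * k + 1 - j) = t j" "t (2 * k + 1 - j) = r j" "2 * k + 1 - (2 * k + 1 - j) = j"
      using j by (auto simp: r_def t_def of_nat_diff)
    \<comment> \<open>The reflected index has the opposite sign, so the paired terms give a
      difference of two values of \<open>U\<close>.\<close>
    have "(-1 :: complex) ^ (2 * k + 1 - j + 1) = (-1) ^ j"
      using j by (simp add: minus_one_power_iff)
    thus "f j + f (2 * k + 1 - j) = (-1) ^ (j+1) * c_coeff j k * (\<beta> j * \<beta> (2 * k + 1 - j))"
      unfolding f_def swap c by (simp add: algebra_simps)
  qed
  also have "\<dots> = (\<Sum>j=0..k. (-1) ^ (j+1) * c_coeff j k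
            * of_real (bernoulli (2*j)) * of_real (bernoulli (4*k+2-2*j))
            / (fact (2*j) * fact (4*k+2-2*j)))"
  proof (intro sum.cong refl)
    fix j assume "j \<in> {0..k}"
    hence "2 * (2 * k + 1 - j) = 4 * k + 2 - 2 * j" by auto
    thus "(-1) ^ (j+1) * c_coeff j k * (\<beta> j * \<beta> (2 * k + 1 - j)) =
        (-1) ^ (j+1) * c_coeff j k * of_real (bernoulli (2*j)) * of_real (bernoulli (4*k+2-2*j))
            / (fact (2*j) * fact (4*k+2-2*j))"
      by (simp add: \<beta>_def)
  qed
  finally show ?thesis .
qed

theorem theorem3p3:
  fixes k :: nat
  assumes "k \<ge> 1"
  shows "zeta (of_nat (4*k+1)) =
      (2 * of_real pi) ^ (4*k+1) / (2 * of_real (b_coeff k)) *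
        (\<Sum>j=0..k. (-1) ^ (j+1) * c_coeff j k
            * of_real (bernoulli (2*j)) * of_real (bernoulli (4*k+2-2*j))
            / (fact (2*j) * fact (4*k+2-2*j)))
    + (-1) ^ k * 2 ^ (2*k+1) / of_real (b_coeff k)
        * lambert (- of_real (exp (- 3 * pi))) (- 4 * of_nat k - 1)
    - of_real (a_coeff k) / (2 ^ (4*k-1) * of_real (b_coeff k))
        * lambert (of_real (exp (- 4 * pi))) (- 4 * of_nat k - 1)
    + 2 ^ (2*k) / (2 ^ (2*k-1) * of_real (b_coeff k))
        * lambert (of_real (exp (- 6 * pi))) (- 4 * of_nat k - 1)"
proof -
  define b :: complex where "b = of_real (b_coeff k)"
  have "b \<noteq> 0" using b_coeff_nonzero[OF assms] by (simp add: b_def)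
  have e: "- of_nat (4 * k + 1) = (- 4 * of_nat k - 1 :: complex)" by simp
  \<comment> \<open>Absorbs the factors \<open>2\<close> of the Lambert terms into the exponents
    \<open>4 * k - 1\<close> and \<open>2 * k - 1\<close>; the natural subtractions do not truncate
    as \<open>k \<ge> 1\<close>.\<close>
  have p1: "(2 :: complex) ^ (4 * k) = 2 * 2 ^ (4 * k - 1)" "(2 :: complex) ^ (2 * k) = 2 * 2 ^ (2 * k - 1)"
    using assms by (simp_all flip: power_Suc)
  have p2: "(-1) ^ k * 2 ^ (2 * k + 1) = (2 * (-4) ^ k :: complex)"
    by (simp add: power_mult flip: power_mult_distrib)
  have "zeta (of_nat (4 * k + 1)) = (b * zeta (of_nat (4 * k + 1))) / b"
    using \<open>b \<noteq> 0\<close> by simp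
  also note zeta_lambert_ramanujan[OF assms, unfolded ramanujan_poly_c_coeff e, folded b_def]
  finally show ?thesis
    unfolding p2 b_def [symmetric] using \<open>b \<noteq> 0\<close>
    by (simp add: p1 add_divide_distrib diff_divide_distrib)
qed

end
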